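(* Let $X$ be a smooth vector field on a smooth manifold $M$ that admits 1) a first integral $h\in C^\infty(M)$ that is regular on $\operatorname{supp}(X)$, and 2) a transversally invariant Riemannian metric $g$ on $M$. Then $X$ is Hamiltonian on $M$ with respect to the Poisson structure of rank at most two defined by $$\pi:=\begin{cases}\dfrac{\nabla h}{g(\nabla h,\nabla h)}\wedge X&\text{on }\operatorname{supp}(X),\\0&\text{elsewhere}.\end{cases}$$
   Context: For a Riemannian metric $g$, let $\eta$ be the dual metric on $T^*M$, and $\nabla h=\eta^\sharp(\mathrm{d}h)$ the gradient. For an orbit $O$ of $X$ and $m\in O$, $T_mO^\circ\subseteq T_m^*M$ denotes the annihilator of $T_mO$, with the inner product induced by $\eta$. The metric $g$ is transversally invariant (for $X$) if for each $m\in M$, with orbit $O$, and each $t$ for which the flow $\mathrm{Fl}^t_X(m)$ is defined, the map $(\mathrm{d}_m\mathrm{Fl}^t_X)^*:T_{\mathrm{Fl}^t_X(m)}O^\circ\to T_mO^\circ$ is an isometry. A first integral of $X$ is a function $h$ with $\mathrm{d}h(X)=0$; it is regular on a set if $\mathrm{d}h$ is nonzero at each of its points. $\operatorname{supp}(X)$ is the closure of $\{X\ne 0\}$. A Poisson structure is a bivector field $\pi$ with $[\pi,\pi]=0$ (Schouten–Nijenhuis bracket); $\pi^\sharp\alpha=\mathbf{i}_\alpha\pi=\pi(\alpha,\cdot)$, the rank at $x$ is $\dim\pi^\sharp(T^*_xM)$; $X$ is Hamiltonian on $M$ with respect to $\pi$ if $X=\pi^\sharp\mathrm{d}f$ for some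 $f\in C^\infty(M)$. *)

theory Defs
  imports "HOL-Analysis.Analysis" "HOL-Library.Function_Algebras"
begin

text \<open>
  Smooth manifolds are given by an atlas on a Hausdorff, second countable type, modelled on a
  Euclidean space. Tangent vectors are families of coordinate representations, one for each chart
  of the atlas at the base point, related by the transformation law. Covectors and bivectors are
  functions on tangent vectors and covectors, so all of these are elements of function spaces,
  which are real vector spaces pointwise.
\<close>

instantiation "fun" :: (type, real_vector) real_vector
begin

definition scaleR_fun :: "real \<Rightarrow> ('a \<Rightarrow> 'b) \<Rightarrow> 'a \<Rightarrow> 'b"
  where "scaleR_fun r f = (\<lambda>x. r *\<^sub>R f x)"

instance
  by standard (simp_all add: scaleR_fun_def fun_eq_iff scaleR_add_right scaleR_add_left)

end

section \<open>Smooth functions and atlases\<close>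

text \<open>Both notions are meant for open sets \<open>S\<close>. On a Euclidean space, differentiability together
  with \<open>C\<^sup>k\<close> regularity of all directional derivatives is \<open>C\<^bsup>k+1\<^esup>\<close> regularity.\<close>

primrec Ck_on :: "nat \<Rightarrow> ('e::euclidean_space \<Rightarrow> 'f::real_normed_vector) \<Rightarrow> 'e set \<Rightarrow> bool" where
  "Ck_on 0 f S \<longleftrightarrow> continuous_on S f"
| "Ck_on (Suc k) f S \<longleftrightarrow>
     (\<forall>x\<in>S. f differentiable (at x)) \<and> (\<forall>v. Ck_on k (\<lambda>x. frechet_derivative f (at x) v) S)"

definition smooth_on :: "('e::euclidean_space \<Rightarrow> 'f::real_normed_vector) \<Rightarrow> 'e set \<Rightarrow> bool"
  where "smooth_on f S \<longleftrightarrow> (\<forall>k. Ck_on k f S)"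

text \<open>Domain and coordinate map; values of the map outside the domain are irrelevant.\<close>

type_synonym ('a, 'e) chart = "'a set \<times> ('a \<Rightarrow> 'e)"

abbreviation chart_inv :: "('a, 'e) chart \<Rightarrow> 'e \<Rightarrow> 'a"
  where "chart_inv c \<equiv> inv_into (fst c) (snd c)"

abbreviation chart_range :: "('a, 'e) chart \<Rightarrow> 'e set"
  where "chart_range c \<equiv> snd c ` fst c"

definition smooth_atlas ::
    "('a::{t2_space, second_countable_topology}, 'e::euclidean_space) chart set \<Rightarrow> bool"
  where "smooth_atlas A \<longleftrightarrow>
    (\<forall>c\<in>A. open (fst c) \<and> open (chart_range c)
       \<and> homeomorphism (fst c) (chart_range c) (snd c) (chart_inv c))
    \<and> (\<Union>c\<in>A. fst c) = UNIV
    \<and> (\<forall>b\<in>A. \<forall>c\<in>A. smooth_on (snd c \<circ> chart_inv b) (snd b ` (fst b \<inter> fst c)))"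

definition charts_at :: "('a, 'e) chart set \<Rightarrow> 'a \<Rightarrow> ('a, 'e) chart set"
  where "charts_at A p = {c \<in> A. p \<in> fst c}"

definition smooth_fun :: "('a, 'e::euclidean_space) chart set \<Rightarrow> ('a \<Rightarrow> real) \<Rightarrow> bool"
  where "smooth_fun A h \<longleftrightarrow> (\<forall>c\<in>A. smooth_on (h \<circ> chart_inv c) (chart_range c))"

section \<open>Tangent vectors, covectors, differentials\<close>

type_synonym ('a, 'e) tvec = "('a, 'e) chart \<Rightarrow> 'e"
type_synonym ('a, 'e) covec = "('a, 'e) tvec \<Rightarrow> real"

definition tangent_space ::
    "('a, 'e::euclidean_space) chart set \<Rightarrow> 'a \<Rightarrow> ('a, 'e) tvec set"
  where "tangent_space A p =
    {v. (\<forall>b\<in>charts_at A p. \<forall>c\<in>charts_at A p.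
           v c = frechet_derivative (snd c \<circ> chart_inv b) (at (snd b p)) (v b))
      \<and> (\<forall>c. c \<notin> charts_at A p \<longrightarrow> v c = 0)}"

text \<open>The tangent vector at \<open>p\<close> with coordinate representation \<open>u\<close> in the chart \<open>c\<close>.\<close>

definition coord_vec ::
    "('a, 'e::euclidean_space) chart set \<Rightarrow> ('a, 'e) chart \<Rightarrow> 'a \<Rightarrow> 'e \<Rightarrow> ('a, 'e) tvec"
  where "coord_vec A c p u =
    (\<lambda>b. if b \<in> charts_at A p
         then frechet_derivative (snd b \<circ> chart_inv c) (at (snd c p)) u else 0)"

definition linear_functional_on :: "'v::real_vector set \<Rightarrow> ('v \<Rightarrow> real) \<Rightarrow> bool"
  where "linear_functional_on V f \<longleftrightarrow>
    (\<forall>v\<in>V. \<forall>w\<in>V. f (v + w) = f v + f w) \<and> (\<forall>a. \<forall>v\<in>V. f (a *\<^sub>R v) = a * f v)"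

text \<open>The dual of the tangent space; covectors are extended by zero off the tangent space in order
  to be determined by their values there.\<close>

definition cotangent_space ::
    "('a, 'e::euclidean_space) chart set \<Rightarrow> 'a \<Rightarrow> ('a, 'e) covec set"
  where "cotangent_space A p =
    {\<alpha>. linear_functional_on (tangent_space A p) \<alpha> \<and> (\<forall>v. v \<notin> tangent_space A p \<longrightarrow> \<alpha> v = 0)}"

text \<open>For \<open>i \<in> Basis\<close> this is the differential at \<open>p\<close> of the \<open>i\<close>-th coordinate function of \<open>c\<close>.\<close>

definition coord_covec ::
    "('a, 'e::euclidean_space) chart set \<Rightarrow> ('a, 'e) chart \<Rightarrow> 'a \<Rightarrow> 'e \<Rightarrow> ('a, 'e) covec"
  where "coord_covec A c p i = (\<lambda>v. if v \<in> tangent_space A p then v c \<bullet> i else 0)"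

text \<open>The choice of chart in the next two definitions is immaterial, by the chain rule.\<close>

definition diff_fun ::
    "('a, 'e::euclidean_space) chart set \<Rightarrow> ('a \<Rightarrow> real) \<Rightarrow> 'a \<Rightarrow> ('a, 'e) covec"
  where "diff_fun A h p =
    (\<lambda>v. if v \<in> tangent_space A p
         then (let c = (SOME c. c \<in> charts_at A p)
               in frechet_derivative (h \<circ> chart_inv c) (at (snd c p)) (v c))
         else 0)"

definition diff_map ::
    "('a, 'e::euclidean_space) chart set \<Rightarrow> ('a \<Rightarrow> 'a) \<Rightarrow> 'a \<Rightarrow> ('a, 'e) tvec \<Rightarrow> ('a, 'e) tvec"
  where "diff_map A F p v =
    (\<lambda>c. if c \<in> charts_at A (F p)
         then (let b = (SOME b. b \<in> charts_at A p)
               in frechet_derivative (snd c \<circ> F \<circ> chart_inv b) (at (snd b p)) (v b))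
         else 0)"

text \<open>The transpose of \<^term>\<open>diff_map A F p\<close>, from covectors at \<open>F p\<close> to covectors at \<open>p\<close>.\<close>

definition pullback ::
    "('a, 'e::euclidean_space) chart set \<Rightarrow> ('a \<Rightarrow> 'a) \<Rightarrow> 'a \<Rightarrow> ('a, 'e) covec \<Rightarrow> ('a, 'e) covec"
  where "pullback A F p \<alpha> = (\<lambda>v. if v \<in> tangent_space A p then \<alpha> (diff_map A F p v) else 0)"

text \<open>For a bilinear form \<open>B\<close> on the cotangent space at \<open>p\<close>, the form \<open>B \<alpha> -\<close> is an element of the
  bidual of the tangent space; this is the corresponding tangent vector.\<close>

definition sharp ::
    "('a, 'e::euclidean_space) chart set \<Rightarrow> 'a \<Rightarrow> (('a, 'e) covec \<Rightarrow> ('a, 'e) covec \<Rightarrow> real)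
      \<Rightarrow> ('a, 'e) covec \<Rightarrow> ('a, 'e) tvec"
  where "sharp A p B \<alpha> =
    (THE v. v \<in> tangent_space A p \<and> (\<forall>\<beta>\<in>cotangent_space A p. \<beta> v = B \<alpha> \<beta>))"

section \<open>Vector fields and their flows\<close>

definition vector_field ::
    "('a, 'e::euclidean_space) chart set \<Rightarrow> ('a \<Rightarrow> ('a, 'e) tvec) \<Rightarrow> bool"
  where "vector_field A X \<longleftrightarrow>
    (\<forall>p. X p \<in> tangent_space A p)
    \<and> (\<forall>c\<in>A. smooth_on (\<lambda>x. X (chart_inv c x) c) (chart_range c))"

definition supp :: "('a::topological_space \<Rightarrow> ('a, 'e::euclidean_space) tvec) \<Rightarrow> 'a set"
  where "supp X = closure {p. X p \<noteq> 0}"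

definition has_velocity ::
    "('a::topological_space, 'e::euclidean_space) chart set \<Rightarrow> (real \<Rightarrow> 'a) \<Rightarrow> ('a, 'e) tvec
      \<Rightarrow> real \<Rightarrow> bool"
  where "has_velocity A \<gamma> v t \<longleftrightarrow>
    isCont \<gamma> t \<and> v \<in> tangent_space A (\<gamma> t)
    \<and> (\<forall>c\<in>charts_at A (\<gamma> t). ((snd c \<circ> \<gamma>) has_vector_derivative v c) (at t))"

definition integral_curve ::
    "('a::topological_space, 'e::euclidean_space) chart set \<Rightarrow> ('a \<Rightarrow> ('a, 'e) tvec)
      \<Rightarrow> real set \<Rightarrow> (real \<Rightarrow> 'a) \<Rightarrow> bool"
  where "integral_curve A X J \<gamma> \<longleftrightarrow>
    open J \<and> is_interval J \<and> (\<forall>t\<in>J. has_velocity A \<gamma> (X (\<gamma> t)) t)"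

definition flows_to ::
    "('a::topological_space, 'e::euclidean_space) chart set \<Rightarrow> ('a \<Rightarrow> ('a, 'e) tvec)
      \<Rightarrow> real \<Rightarrow> 'a \<Rightarrow> 'a \<Rightarrow> bool"
  where "flows_to A X t m y \<longleftrightarrow>
    (\<exists>J \<gamma>. integral_curve A X J \<gamma> \<and> 0 \<in> J \<and> t \<in> J \<and> \<gamma> 0 = m \<and> \<gamma> t = y)"

definition flow_defined ::
    "('a::topological_space, 'e::euclidean_space) chart set \<Rightarrow> ('a \<Rightarrow> ('a, 'e) tvec)
      \<Rightarrow> real \<Rightarrow> 'a \<Rightarrow> bool"
  where "flow_defined A X t m \<longleftrightarrow> (\<exists>y. flows_to A X t m y)"

text \<open>The maximal flow; the value is meaningful only where \<^const>\<open>flow_defined\<close> holds, which is an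
  open condition on \<open>m\<close>.\<close>

definition flow ::
    "('a::topological_space, 'e::euclidean_space) chart set \<Rightarrow> ('a \<Rightarrow> ('a, 'e) tvec)
      \<Rightarrow> real \<Rightarrow> 'a \<Rightarrow> 'a"
  where "flow A X t m = (THE y. flows_to A X t m y)"

text \<open>The tangent space at \<open>m\<close> of the orbit \<open>O\<close> of \<open>X\<close> through \<open>m\<close>. The orbit is an immersed
  submanifold parametrized by the flow \<open>t \<mapsto> Fl\<^sup>t(m)\<close>, and its tangent space at \<open>m\<close> is the image of
  the differential of this parametrization at \<open>t = 0\<close>.\<close>

definition orbit_tangent_space ::
    "('a::topological_space, 'e::euclidean_space) chart set \<Rightarrow> ('a \<Rightarrow> ('a, 'e) tvec)
      \<Rightarrow> 'a \<Rightarrow> ('a, 'e) tvec set"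
  where "orbit_tangent_space A X m = span {v. has_velocity A (\<lambda>t. flow A X t m) v 0}"

definition orbit_annihilator ::
    "('a::topological_space, 'e::euclidean_space) chart set \<Rightarrow> ('a \<Rightarrow> ('a, 'e) tvec)
      \<Rightarrow> 'a \<Rightarrow> ('a, 'e) covec set"
  where "orbit_annihilator A X m =
    {\<alpha> \<in> cotangent_space A m. \<forall>v\<in>orbit_tangent_space A X m. \<alpha> v = 0}"

definition first_integral ::
    "('a, 'e::euclidean_space) chart set \<Rightarrow> ('a \<Rightarrow> ('a, 'e) tvec) \<Rightarrow> ('a \<Rightarrow> real) \<Rightarrow> bool"
  where "first_integral A X h \<longleftrightarrow> smooth_fun A h \<and> (\<forall>p. diff_fun A h p (X p) = 0)"

definition regular_on ::
    "('a, 'e::euclidean_space) chart set \<Rightarrow> ('a \<Rightarrow> real) \<Rightarrow> 'a set \<Rightarrow> bool"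
  where "regular_on A h S \<longleftrightarrow> (\<forall>p\<in>S. diff_fun A h p \<noteq> 0)"

section \<open>Riemannian metrics\<close>

type_synonym ('a, 'e) metric_field = "'a \<Rightarrow> ('a, 'e) tvec \<Rightarrow> ('a, 'e) tvec \<Rightarrow> real"

definition riemannian_metric ::
    "('a, 'e::euclidean_space) chart set \<Rightarrow> ('a, 'e) metric_field \<Rightarrow> bool"
  where "riemannian_metric A g \<longleftrightarrow>
    (\<forall>p. \<forall>v\<in>tangent_space A p.
       linear_functional_on (tangent_space A p) (g p v)
       \<and> (\<forall>w\<in>tangent_space A p. g p v w = g p w v)
       \<and> (v \<noteq> 0 \<longrightarrow> g p v v > 0))
    \<and> (\<forall>c\<in>A. \<forall>i\<in>Basis. \<forall>j\<in>Basis.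
         smooth_on (\<lambda>x. g (chart_inv c x)
             (coord_vec A c (chart_inv c x) i) (coord_vec A c (chart_inv c x) j))
           (chart_range c))"

text \<open>The dual metric is the metric on the cotangent spaces transported along the isomorphism
  \<open>v \<mapsto> g p v -\<close>, whose inverse is the following map.\<close>

definition metric_dual_vec ::
    "('a, 'e::euclidean_space) chart set \<Rightarrow> ('a, 'e) metric_field \<Rightarrow> 'a
      \<Rightarrow> ('a, 'e) covec \<Rightarrow> ('a, 'e) tvec"
  where "metric_dual_vec A g p \<alpha> =
    (THE v. v \<in> tangent_space A p \<and> (\<forall>w\<in>tangent_space A p. g p v w = \<alpha> w))"

definition dual_metric ::
    "('a, 'e::euclidean_space) chart set \<Rightarrow> ('a, 'e) metric_field \<Rightarrow> 'a
      \<Rightarrow> ('a, 'e) covec \<Rightarrow> ('a, 'e) covec \<Rightarrow> real"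
  where "dual_metric A g p \<alpha> \<beta> = g p (metric_dual_vec A g p \<alpha>) (metric_dual_vec A g p \<beta>)"

definition gradient ::
    "('a, 'e::euclidean_space) chart set \<Rightarrow> ('a, 'e) metric_field \<Rightarrow> ('a \<Rightarrow> real)
      \<Rightarrow> 'a \<Rightarrow> ('a, 'e) tvec"
  where "gradient A g h p = sharp A p (dual_metric A g p) (diff_fun A h p)"

definition transversally_invariant ::
    "('a::topological_space, 'e::euclidean_space) chart set \<Rightarrow> ('a \<Rightarrow> ('a, 'e) tvec)
      \<Rightarrow> ('a, 'e) metric_field \<Rightarrow> bool"
  where "transversally_invariant A X g \<longleftrightarrow>
    (\<forall>m t. flow_defined A X t m \<longrightarrow>
       bij_betw (pullback A (flow A X t) m)
         (orbit_annihilator A X (flow A X t m)) (orbit_annihilator A X m)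
       \<and> (\<forall>\<alpha>\<in>orbit_annihilator A X (flow A X t m).
            \<forall>\<beta>\<in>orbit_annihilator A X (flow A X t m).
            dual_metric A g m (pullback A (flow A X t) m \<alpha>) (pullback A (flow A X t) m \<beta>)
              = dual_metric A g (flow A X t m) \<alpha> \<beta>))"

section \<open>Poisson structures\<close>

text \<open>Bivectors at \<open>p\<close> are alternating bilinear forms on the cotangent space at \<open>p\<close>; their values
  on other arguments are irrelevant.\<close>

type_synonym ('a, 'e) bivec = "('a, 'e) covec \<Rightarrow> ('a, 'e) covec \<Rightarrow> real"

definition wedge :: "('a, 'e) tvec \<Rightarrow> ('a, 'e) tvec \<Rightarrow> ('a, 'e) bivec"
  where "wedge v w = (\<lambda>\<alpha> \<beta>. \<alpha> v * \<beta> w - \<alpha> w * \<beta> v)"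

definition bivec_coeff ::
    "('a, 'e::euclidean_space) chart set \<Rightarrow> ('a, 'e) chart \<Rightarrow> ('a \<Rightarrow> ('a, 'e) bivec)
      \<Rightarrow> 'e \<Rightarrow> 'e \<Rightarrow> 'e \<Rightarrow> real"
  where "bivec_coeff A c P i j x =
    P (chart_inv c x) (coord_covec A c (chart_inv c x) i) (coord_covec A c (chart_inv c x) j)"

definition bivector_field ::
    "('a, 'e::euclidean_space) chart set \<Rightarrow> ('a \<Rightarrow> ('a, 'e) bivec) \<Rightarrow> bool"
  where "bivector_field A P \<longleftrightarrow>
    (\<forall>p. \<forall>\<alpha>\<in>cotangent_space A p.
       linear_functional_on (cotangent_space A p) (P p \<alpha>)
       \<and> (\<forall>\<beta>\<in>cotangent_space A p. P p \<alpha> \<beta> = - P p \<beta> \<alpha>))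
    \<and> (\<forall>c\<in>A. \<forall>i\<in>Basis. \<forall>j\<in>Basis. smooth_on (bivec_coeff A c P i j) (chart_range c))"

text \<open>The component \<open>[P, Q]\<^bsup>ijk\<^esup>\<close> in the chart \<open>c\<close>, at the point with coordinates \<open>x\<close>, of the
  Schouten--Nijenhuis bracket of two bivector fields: the cyclic sum over \<open>(i, j, k)\<close> of
  \<open>\<Sum>\<^sub>l P\<^bsup>il\<^esup> \<partial>\<^sub>l Q\<^bsup>jk\<^esup> + Q\<^bsup>il\<^esup> \<partial>\<^sub>l P\<^bsup>jk\<^esup>\<close>. The sign is that of the convention
  \<open>[X\<^sub>1 \<and> X\<^sub>2, Y\<^sub>1 \<and> Y\<^sub>2] = \<Sum>\<^sub>r\<^sub>s (-1)\<^bsup>r+s\<^esup> [X\<^sub>r, Y\<^sub>s] \<and> X\<^sub>3\<^sub>-\<^sub>r \<and> Y\<^sub>3\<^sub>-\<^sub>s\<close>.\<close>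

definition schouten_coeff ::
    "('a, 'e::euclidean_space) chart set \<Rightarrow> ('a, 'e) chart
      \<Rightarrow> ('a \<Rightarrow> ('a, 'e) bivec) \<Rightarrow> ('a \<Rightarrow> ('a, 'e) bivec) \<Rightarrow> 'e \<Rightarrow> 'e \<Rightarrow> 'e \<Rightarrow> 'e \<Rightarrow> real"
  where "schouten_coeff A c P Q i j k x =
    (let D = (\<lambda>P Q i j k. \<Sum>l\<in>Basis.
           bivec_coeff A c P i l x * frechet_derivative (bivec_coeff A c Q j k) (at x) l)
     in D P Q i j k + D P Q j k i + D P Q k i j
        + D Q P i j k + D Q P j k i + D Q P k i j)"

definition poisson_structure ::
    "('a, 'e::euclidean_space) chart set \<Rightarrow> ('a \<Rightarrow> ('a, 'e) bivec) \<Rightarrow> bool"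
  where "poisson_structure A P \<longleftrightarrow>
    bivector_field A P
    \<and> (\<forall>c\<in>A. \<forall>x\<in>chart_range c. \<forall>i\<in>Basis. \<forall>j\<in>Basis. \<forall>k\<in>Basis.
         schouten_coeff A c P P i j k x = 0)"

definition bivec_rank ::
    "('a, 'e::euclidean_space) chart set \<Rightarrow> ('a \<Rightarrow> ('a, 'e) bivec) \<Rightarrow> 'a \<Rightarrow> nat"
  where "bivec_rank A P p = dim (sharp A p (P p) ` cotangent_space A p)"

definition hamiltonian ::
    "('a, 'e::euclidean_space) chart set \<Rightarrow> ('a \<Rightarrow> ('a, 'e) bivec)
      \<Rightarrow> ('a \<Rightarrow> ('a, 'e) tvec) \<Rightarrow> bool"
  where "hamiltonian A P X \<longleftrightarrow>
    (\<exists>f. smooth_fun A f \<and> (\<forall>p. X p = sharp A p (P p) (diff_fun A f p)))"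

end

theory Submission
  imports Defs
begin

text \<open>
  As \<open>dh(X) = 0\<close>, the bivector \<open>\<pi>\<close> sends \<open>dh\<close> to \<open>X\<close>, and \<open>[\<pi>, \<pi>]\<close> is a multiple of
  \<open>V \<and> X \<and> [X, V]\<close>, where \<open>V = \<nabla>h / g(\<nabla>h, \<nabla>h)\<close>. Pulling back along the flow of \<open>X\<close> fixes \<open>dh\<close>
  and preserves inner products of covectors that annihilate \<open>X\<close>. Hence \<open>g(\<nabla>h, \<nabla>h)\<close> is constant
  along the flow, and the differential of the flow carries \<open>\<nabla>h\<close> to \<open>\<nabla>h\<close> modulo \<open>X\<close>. Differentiating
  at time \<open>0\<close> shows that \<open>[X, V]\<close> is a multiple of \<open>X\<close> wherever \<open>X \<noteq> 0\<close>, so that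
  \<open>[\<pi>, \<pi>] = 0\<close> there; where \<open>X = 0\<close>, every term of the coordinate formula for \<open>[\<pi>, \<pi>]\<close> contains a
  vanishing coefficient of \<open>\<pi>\<close>.
\<close>

section \<open>Calculus of smooth functions\<close>

text \<open>Transversal invariance concerns the differential of \<open>flow\<close>, which is only a
  definite description. An ODE theory must therefore produce, in one chart, solutions that are
  differentiable in the initial point, and uniqueness of integral curves must identify them with
  \<open>flow\<close>. What is then used is the differential at a single point and its time
  derivative at 0, which is the derivative of the field. "Modulo X" hides a moving target, since the
  covectors that annihilate X change along the trajectory. Instead of a differentiable family of
  them, the proof takes the part of a vector orthogonal to X in the chart, scaled by the squared
  length of X. This is polynomial in the data and vanishes for all small times, so it can be
  differentiated at time 0. The boundary of the support causes no trouble: X vanishes off its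
  support, so the wedge formula for the bivector remains true on the whole open set where the
  gradient is nonzero, and the bivector is zero on the open complement of the support. These two
  sets cover M.\<close>

lemma has_derivative_cong_open:
  assumes "open S" "x \<in> S" "\<And>y. y \<in> S \<Longrightarrow> f y = g y"
  shows "(f has_derivative D) (at x) \<longleftrightarrow> (g has_derivative D) (at x)"
  using has_derivative_transform_within_open[of f D x UNIV S g]
    has_derivative_transform_within_open[of g D x UNIV S f] assms by auto

lemma frechet_derivative_cong_open:
  assumes "open S" "x \<in> S" "\<And>y. y \<in> S \<Longrightarrow> f y = g y"
  shows "frechet_derivative f (at x) = frechet_derivative g (at x)"
  by (simp add: frechet_derivative_def has_derivative_cong_open[OF assms])

lemma Ck_on_cong:
  assumes "open S" "\<And>y. y \<in> S \<Longrightarrow> f y = g y"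
  shows "Ck_on k f S \<longleftrightarrow> Ck_on k g S"
  using assms(2)
proof (induction k arbitrary: f g)
  case 0
  then show ?case by (simp cong: continuous_on_cong)
next
  case (Suc k)
  have "f differentiable (at x) \<longleftrightarrow> g differentiable (at x)" if "x \<in> S" for x
    using has_derivative_cong_open[OF assms(1) that, of f g] Suc.prems by (simp add: differentiable_def)
  moreover have "Ck_on k (\<lambda>x. frechet_derivative f (at x) v) S \<longleftrightarrow>
      Ck_on k (\<lambda>x. frechet_derivative g (at x) v) S" for v
    by (intro Suc.IH) (metis Suc.prems assms(1) frechet_derivative_cong_open)
  ultimately show ?case by simp
qed

lemma Ck_on_subset: "Ck_on k f S \<Longrightarrow> T \<subseteq> S \<Longrightarrow> Ck_on k f T"
  by (induction k arbitrary: f) (auto intro: continuous_on_subset)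

text \<open>Differentiability is required at full neighbourhoods, so openness enters only through
  continuity. This is what glues the coefficients of the bivector field across the boundary of the
  support.\<close>

lemma Ck_on_Un:
  "open S \<Longrightarrow> open T \<Longrightarrow> Ck_on k f S \<Longrightarrow> Ck_on k f T \<Longrightarrow> Ck_on k f (S \<union> T)"
  by (induction k arbitrary: f) (auto intro: continuous_on_open_Un)

lemma Ck_on_Suc_imp: "Ck_on (Suc k) f S \<Longrightarrow> Ck_on k f S"
proof (induction k arbitrary: f)
  case 0
  then show ?case
    by (auto intro!: continuous_at_imp_continuous_on differentiable_imp_continuous_within)
next
  case (Suc k)
  then show ?case by (metis Ck_on.simps(2))
qed

lemma Ck_on_Suc_has_derivative:
  "Ck_on (Suc k) f S \<Longrightarrow> x \<in> S \<Longrightarrow> (f has_derivative frechet_derivative f (at x)) (at x)"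
  by (simp add: frechet_derivative_works)

text \<open>\<open>Ck_on\<close> refers to the chosen derivative \<open>frechet_derivative\<close>.
  By uniqueness of derivatives any explicit formula \<open>D\<close> may take its place, which is
  how all the closure rules below are proved.\<close>

lemma Ck_on_SucI:
  assumes "open S" "\<And>x. x \<in> S \<Longrightarrow> (f has_derivative D x) (at x)"
    and "\<And>v. Ck_on k (\<lambda>x. D x v) S"
  shows "Ck_on (Suc k) f S"
proof -
  have "frechet_derivative f (at x) = D x" if "x \<in> S" for x
    using assms(2)[OF that] by (simp add: frechet_derivative_at[symmetric])
  then have "Ck_on k (\<lambda>x. frechet_derivative f (at x) v) S" for v
    using Ck_on_cong[OF assms(1), of "\<lambda>x. frechet_derivative f (at x) v" "\<lambda>x. D x v"] assms(3)
    by simp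
  then show ?thesis using assms(2) by (auto simp: differentiable_def)
qed

lemma Ck_on_const: "open S \<Longrightarrow> Ck_on k (\<lambda>x. c) S"
proof (induction k arbitrary: c)
  case (Suc k)
  then show ?case by (intro Ck_on_SucI[where D = "\<lambda>x v. 0"]) auto
qed simp

lemma Ck_on_add:
  assumes "open S" "Ck_on k f S" "Ck_on k g S"
  shows "Ck_on k (\<lambda>x. f x + g x) S"
  using assms(2,3)
proof (induction k arbitrary: f g)
  case 0
  then show ?case by (auto intro: continuous_intros)
next
  case (Suc k)
  show ?case
  proof (rule Ck_on_SucI[OF assms(1)])
    show "((\<lambda>x. f x + g x) has_derivative
        (\<lambda>v. frechet_derivative f (at x) v + frechet_derivative g (at x) v)) (at x)"
      if "x \<in> S" for x
      by (intro has_derivative_add Suc.prems[THEN Ck_on_Suc_has_derivative] that)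
    show "Ck_on k (\<lambda>x. frechet_derivative f (at x) v + frechet_derivative g (at x) v) S" for v
      using Suc.prems by (intro Suc.IH) auto
  qed
qed

text \<open>One induction serves real products, scalar multiples and inner products. In the product
  rule one factor stays undifferentiated, and its regularity is lowered by
  \<open>Ck_on_Suc_imp\<close> before the induction hypothesis applies.\<close>

lemma (in bounded_bilinear) Ck_on:
  assumes "open S" "Ck_on k f S" "Ck_on k g S"
  shows "Ck_on k (\<lambda>x. prod (f x) (g x)) S"
  using assms(2,3)
proof (induction k arbitrary: f g)
  case 0
  then show ?case by (auto intro: continuous_on)
next
  case (Suc k)
  show ?case
  proof (rule Ck_on_SucI[OF assms(1)])
    show "((\<lambda>x. prod (f x) (g x)) has_derivative (\<lambda>v. prod (f x) (frechet_derivative g (at x) v)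
        + prod (frechet_derivative f (at x) v) (g x))) (at x)" if "x \<in> S" for x
      by (intro FDERIV Suc.prems[THEN Ck_on_Suc_has_derivative] that)
    fix v
    show "Ck_on k (\<lambda>x. prod (f x) (frechet_derivative g (at x) v)
        + prod (frechet_derivative f (at x) v) (g x)) S"
      using Suc.prems Suc.prems[THEN Ck_on_Suc_imp] by (intro Ck_on_add assms(1) Suc.IH) auto
  qed
qed

text \<open>The derivative of 1/f again contains 1/f, so the induction is on \<open>k\<close> for a
  fixed \<open>f\<close>.\<close>

lemma Ck_on_inverse:
  fixes f :: "'e::euclidean_space \<Rightarrow> real"
  assumes "open S" "Ck_on k f S" "\<And>x. x \<in> S \<Longrightarrow> f x \<noteq> 0"
  shows "Ck_on k (\<lambda>x. inverse (f x)) S"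
  using assms(2)
proof (induction k)
  case 0
  then show ?case using assms(3) by (auto intro: continuous_intros)
next
  case (Suc k)
  have f: "Ck_on k f S" by (rule Ck_on_Suc_imp[OF Suc.prems])
  show ?case
  proof (rule Ck_on_SucI[OF assms(1)])
    show "((\<lambda>x. inverse (f x)) has_derivative
        (\<lambda>v. - (inverse (f x) * frechet_derivative f (at x) v * inverse (f x)))) (at x)"
      if "x \<in> S" for x
      by (intro Deriv.has_derivative_inverse Suc.prems[THEN Ck_on_Suc_has_derivative] assms(3) that)
    fix v
    have "Ck_on k (\<lambda>x. - 1 * (inverse (f x) * frechet_derivative f (at x) v * inverse (f x))) S"
      using Suc f by (intro bounded_bilinear.Ck_on[OF bounded_bilinear_mult] assms(1) Ck_on_const) auto
    then show "Ck_on k (\<lambda>x. - (inverse (f x) * frechet_derivative f (at x) v * inverse (f x))) S"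
      by simp
  qed
qed

lemma smooth_on_subset: "smooth_on f S \<Longrightarrow> T \<subseteq> S \<Longrightarrow> smooth_on f T"
  by (auto simp: smooth_on_def intro: Ck_on_subset)

lemma smooth_on_cong:
  assumes "open S" "\<And>y. y \<in> S \<Longrightarrow> f y = g y"
  shows "smooth_on f S \<longleftrightarrow> smooth_on g S"
  using Ck_on_cong[of S f g] assms by (simp add: smooth_on_def)

lemma smooth_on_Un: "open S \<Longrightarrow> open T \<Longrightarrow> smooth_on f S \<Longrightarrow> smooth_on f T \<Longrightarrow> smooth_on f (S \<union> T)"
  by (simp add: smooth_on_def Ck_on_Un)

lemma smooth_on_const: "open S \<Longrightarrow> smooth_on (\<lambda>x. c) S"
  by (simp add: smooth_on_def Ck_on_const)

lemma smooth_on_add: "open S \<Longrightarrow> smooth_on f S \<Longrightarrow> smooth_on g S \<Longrightarrow> smooth_on (\<lambda>x. f x + g x) S"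
  by (simp add: smooth_on_def Ck_on_add)

lemma smooth_on_sum:
  "open S \<Longrightarrow> (\<And>i. i \<in> I \<Longrightarrow> smooth_on (f i) S) \<Longrightarrow> smooth_on (\<lambda>x. \<Sum>i\<in>I. f i x) S"
  by (induction I rule: infinite_finite_induct) (auto intro: smooth_on_const smooth_on_add)

lemma smooth_on_bilinear:
  assumes "bounded_bilinear b" "open S" "smooth_on f S" "smooth_on g S"
  shows "smooth_on (\<lambda>x. b (f x) (g x)) S"
  using assms(2-) by (simp add: smooth_on_def bounded_bilinear.Ck_on[OF assms(1)])

lemmas smooth_on_mult = smooth_on_bilinear[OF bounded_bilinear_mult]
lemmas smooth_on_scaleR = smooth_on_bilinear[OF bounded_bilinear_scaleR]
lemmas smooth_on_inner = smooth_on_bilinear[OF bounded_bilinear_inner]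

lemma smooth_on_inverse:
  fixes f :: "'e::euclidean_space \<Rightarrow> real"
  shows "open S \<Longrightarrow> smooth_on f S \<Longrightarrow> (\<And>x. x \<in> S \<Longrightarrow> f x \<noteq> 0) \<Longrightarrow> smooth_on (\<lambda>x. inverse (f x)) S"
  by (simp add: smooth_on_def Ck_on_inverse)

lemma smooth_on_diff:
  assumes "open S" "smooth_on f S" "smooth_on g S"
  shows "smooth_on (\<lambda>x. f x - g x) S"
  using smooth_on_add[OF assms(1,2) smooth_on_scaleR[OF assms(1) smooth_on_const[OF assms(1), of "-1"] assms(3)]]
  by simp

lemma smooth_on_frechet_derivative:
  "smooth_on f S \<Longrightarrow> smooth_on (\<lambda>x. frechet_derivative f (at x) v) S"
  unfolding smooth_on_def using Ck_on.simps(2) by blast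

lemma smooth_on_has_derivative:
  "smooth_on f S \<Longrightarrow> x \<in> S \<Longrightarrow> (f has_derivative frechet_derivative f (at x)) (at x)"
  using Ck_on_Suc_has_derivative unfolding smooth_on_def by blast

lemma smooth_on_imp_continuous_on: "smooth_on f S \<Longrightarrow> continuous_on S f"
  by (drule smooth_on_def[THEN iffD1, THEN spec, of _ _ 0]) simp

subsection \<open>Smooth positive definite linear systems\<close>

text \<open>The index set is explicit, rather than built into a matrix type, so that an elimination
  step can pass to a smaller index set.\<close>

definition pos_def_on :: "'i set \<Rightarrow> ('i \<Rightarrow> 'i \<Rightarrow> real) \<Rightarrow> bool"
  where "pos_def_on I G \<longleftrightarrow> (\<forall>i\<in>I. \<forall>j\<in>I. G i j = G j i)
    \<and> (\<forall>z. (\<exists>i\<in>I. z i \<noteq> 0) \<longrightarrow> (\<Sum>i\<in>I. \<Sum>j\<in>I. G i j * z i * z j) > 0)"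

lemma pos_def_on_diag:
  assumes "pos_def_on I G" "finite I" "a \<in> I"
  shows "G a a > 0"
proof -
  have "(\<Sum>i\<in>I. \<Sum>j\<in>I. G i j * (if i = a then 1 else 0) * (if j = a then 1 else 0)) > 0"
    using assms(1,3) unfolding pos_def_on_def by (elim conjE allE impE) (auto intro!: bexI[of _ a])
  moreover have "(\<Sum>i\<in>I. \<Sum>j\<in>I. G i j * (if i = a then 1 else 0) * (if j = a then 1 else 0)) = G a a"
    using assms(2,3) by (simp add: if_distrib[of "(*) _"] sum.delta cong: if_cong)
  ultimately show ?thesis by simp
qed

text \<open>Completing the square in the coordinate \<open>a\<close>: the Schur form at
  \<open>z\<close> is the minimum of the form of \<open>G\<close> over all vectors that agree with
  \<open>z\<close> on \<open>I\<close>.\<close>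

lemma pos_def_on_schur_complement:
  assumes "pos_def_on (insert a I) G" "finite I" "a \<notin> I"
  shows "pos_def_on I (\<lambda>i j. G i j - G i a * G a j * inverse (G a a))"
proof -
  have a: "G a a > 0" using pos_def_on_diag[OF assms(1)] assms(2) by simp
  have sym: "G i j = G j i" if "i \<in> insert a I" "j \<in> insert a I" for i j
    using assms(1) that by (auto simp: pos_def_on_def)
  have "(\<Sum>i\<in>I. \<Sum>j\<in>I. (G i j - G i a * G a j * inverse (G a a)) * z i * z j) > 0"
    if z: "\<exists>i\<in>I. z i \<noteq> 0" for z
  proof -
    define b where "b = (\<Sum>i\<in>I. G a i * z i)"
    \<comment> \<open>This value of the coordinate \<open>a\<close> is the minimizer.\<close>
    define y where "y = z(a := - b * inverse (G a a))"
    have "\<exists>i\<in>insert a I. y i \<noteq> 0" using z assms(3) by (auto simp: y_def)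
    then have "0 < (\<Sum>i\<in>insert a I. \<Sum>j\<in>insert a I. G i j * y i * y j)"
      using assms(1) unfolding pos_def_on_def by blast
    also have "\<dots> = G a a * y a * y a + (\<Sum>j\<in>I. G a j * y a * y j)
        + (\<Sum>i\<in>I. G i a * y i * y a + (\<Sum>j\<in>I. G i j * y i * y j))"
      using assms(2,3) by simp
    also have "\<dots> = G a a * y a * y a + (\<Sum>j\<in>I. G a j * z j * y a)
        + ((\<Sum>i\<in>I. G a i * z i * y a) + (\<Sum>i\<in>I. \<Sum>j\<in>I. G i j * z i * z j))"
      unfolding sum.distrib
      using assms(3) sym by (intro arg_cong2[where f = "(+)"] sum.cong refl) (auto simp: y_def)
    also have "\<dots> = G a a * y a * y a + 2 * b * y a + (\<Sum>i\<in>I. \<Sum>j\<in>I. G i j * z i * z j)"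
      unfolding b_def sum_distrib_right[symmetric] by simp
    also have "G a a * y a * y a + 2 * b * y a = - (b * b * inverse (G a a))"
      using a by (simp add: y_def field_simps)
    also have "b * b * inverse (G a a) = (\<Sum>i\<in>I. \<Sum>j\<in>I. G i a * G a j * inverse (G a a) * z i * z j)"
      unfolding b_def sum_product unfolding sum_distrib_right
      using sym by (intro sum.cong refl) (simp add: mult_ac)
    finally show ?thesis by (simp add: left_diff_distrib sum_subtractf)
  qed
  then show ?thesis using sym by (auto simp: pos_def_on_def)
qed

text \<open>Gaussian elimination, with the Schur complement as the next coefficient matrix.\<close>

lemma smooth_on_pos_def_solution:
  assumes "finite I" "open S"
    and "\<And>x. x \<in> S \<Longrightarrow> pos_def_on I (G x)"
    and "\<And>i j. i \<in> I \<Longrightarrow> j \<in> I \<Longrightarrow> smooth_on (\<lambda>x. G x i j) S"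
    and "\<And>j. j \<in> I \<Longrightarrow> smooth_on (\<lambda>x. r x j) S"
    and "\<And>x j. x \<in> S \<Longrightarrow> j \<in> I \<Longrightarrow> (\<Sum>i\<in>I. G x j i * w x i) = r x j"
    and "i \<in> I"
  shows "smooth_on (\<lambda>x. w x i :: real) S"
  using assms
proof (induction I arbitrary: G r i rule: finite_induct)
  case (insert a I)
  have a: "G x a a > 0" if "x \<in> S" for x
    using pos_def_on_diag insert that by (metis finite_insert insertI1)
  have inv: "smooth_on (\<lambda>x. inverse (G x a a)) S"
    using a insert.prems by (intro smooth_on_inverse) force+
  have wa: "w x a = (r x a - (\<Sum>i\<in>I. G x a i * w x i)) * inverse (G x a a)" if "x \<in> S" for x
  proof -
    have "G x a a * w x a + (\<Sum>i\<in>I. G x a i * w x i) = r x a"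
      using insert that by auto
    then show ?thesis using a[OF that] by (simp add: field_simps)
  qed
  have I: "smooth_on (\<lambda>x. w x i) S" if i: "i \<in> I" for i
  proof (rule insert.IH[where G = "\<lambda>x i j. G x i j - G x i a * G x a j * inverse (G x a a)"
        and r = "\<lambda>x j. r x j - G x j a * r x a * inverse (G x a a)"])
    fix x j assume x: "x \<in> S" and j: "j \<in> I"
    have "G x j a * w x a + (\<Sum>i\<in>I. G x j i * w x i) = r x j"
      using insert x j by auto
    then have "r x j - G x j a * r x a * inverse (G x a a) =
        (\<Sum>i\<in>I. G x j i * w x i) - G x j a * inverse (G x a a) * (\<Sum>i\<in>I. G x a i * w x i)"
      unfolding wa[OF x] by (simp add: algebra_simps)
    also have "\<dots> = (\<Sum>i\<in>I. (G x j i - G x j a * G x a i * inverse (G x a a)) * w x i)"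
      by (simp add: sum_distrib_left algebra_simps sum_subtractf)
    finally show "(\<Sum>i\<in>I. (G x j i - G x j a * G x a i * inverse (G x a a)) * w x i)
        = r x j - G x j a * r x a * inverse (G x a a)" ..
  qed (use insert i inv in \<open>auto intro!: smooth_on_diff smooth_on_mult pos_def_on_schur_complement\<close>)
  have "smooth_on (\<lambda>x. (r x a - (\<Sum>i\<in>I. G x a i * w x i)) * inverse (G x a a)) S"
    using insert.prems inv I by (intro smooth_on_diff smooth_on_mult smooth_on_sum) auto
  then have "smooth_on (\<lambda>x. w x a) S"
    using wa smooth_on_cong[OF \<open>open S\<close>, of "\<lambda>x. w x a"] by force
  then show ?case using I insert.prems by auto
qed simp

section \<open>Local flows of vector fields on Euclidean spaces\<close>

lemma onorm_scaleR_le: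
  fixes v :: "'b::real_normed_vector"
  assumes "norm v \<le> B"
  shows "onorm (\<lambda>x::real. x *\<^sub>R v) \<le> B"
  by (rule onorm_le) (use mult_right_mono[OF assms abs_ge_zero] in \<open>simp add: mult.commute\<close>)

text \<open>A substitute for Gronwall's inequality. At a point \<open>s\<close> where the norm is
  maximal, the mean value inequality gives |y s| <= |y 0| + T (L |y s| + e), and T L <= 1/2 lets the
  term with |y s| be absorbed on the left. Uniqueness, Lipschitz dependence on the initial value,
  linearity of the variational solution and differentiability of the flow all rest on it.\<close>

lemma norm_le_on_short_interval:
  fixes y :: "real \<Rightarrow> 'b::real_normed_vector"
  assumes T: "0 \<le> T" "T * L \<le> 1/2" and L: "0 \<le> L"
    and der: "\<And>t. t \<in> {-T..T} \<Longrightarrow> (y has_vector_derivative y' t) (at t within {-T..T})"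
    and bound: "\<And>t. t \<in> {-T..T} \<Longrightarrow> norm (y' t) \<le> L * norm (y t) + e"
    and t: "t \<in> {-T..T}"
  shows "norm (y t) \<le> 2 * (norm (y 0) + T * e)"
proof -
  have "continuous_on {-T..T} y"
    using der by (rule continuous_on_vector_derivative)
  then have "continuous_on {-T..T} (\<lambda>t. norm (y t))" by (intro continuous_intros)
  then obtain s where s: "s \<in> {-T..T}" and smax: "\<And>t. t \<in> {-T..T} \<Longrightarrow> norm (y t) \<le> norm (y s)"
    using continuous_attains_sup[of "{-T..T}" "\<lambda>t. norm (y t)"] t by auto
  define B where "B = L * norm (y s) + e"
  have B: "norm (y' t) \<le> B" if "t \<in> {-T..T}" for t
    using bound[OF that] mult_left_mono[OF smax[OF that] L] by (simp add: B_def)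
  have B0: "0 \<le> B" using B[OF s] norm_ge_zero order_trans by blast
  have "norm (y s - y 0) \<le> B * norm (s - 0)"
  proof (rule differentiable_bound[where S = "{-T..T}" and f' = "\<lambda>t x. x *\<^sub>R y' t"])
    show "(y has_derivative (\<lambda>x. x *\<^sub>R y' t)) (at t within {-T..T})" if "t \<in> {-T..T}" for t
      using der[OF that] by (simp add: has_vector_derivative_def)
    show "onorm (\<lambda>x. x *\<^sub>R y' t) \<le> B" if "t \<in> {-T..T}" for t
      using B[OF that] by (rule onorm_scaleR_le)
  qed (use s T in auto)
  also have "\<dots> \<le> B * T" using s B0 by (intro mult_left_mono) auto
  also have "\<dots> = T * L * norm (y s) + T * e" by (simp add: B_def algebra_simps)
  also have "\<dots> \<le> 1/2 * norm (y s) + T * e"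
    using T by (intro add_right_mono mult_right_mono) auto
  finally have "norm (y s - y 0) \<le> 1/2 * norm (y s) + T * e" .
  moreover have "norm (y s) \<le> norm (y 0) + norm (y s - y 0)" by norm
  ultimately have "norm (y s) \<le> 2 * (norm (y 0) + T * e)" by simp
  then show ?thesis using smax[OF t] by simp
qed

text \<open>Banach's fixed point theorem for the integral operator, a contraction with factor T L <=
  1/2. The right-hand side may depend on time, so that the variational equation is covered
  too.\<close>

lemma picard_lindelof:
  fixes f :: "real \<Rightarrow> 'b::banach \<Rightarrow> 'b"
  assumes T: "0 < T" "T * L \<le> 1/2" and L: "0 \<le> L"
    and cont: "\<And>u. continuous_on {-T..T} u \<Longrightarrow> continuous_on {-T..T} (\<lambda>t. f t (u t))"
    and lip: "\<And>t y z. t \<in> {-T..T} \<Longrightarrow> norm (f t y - f t z) \<le> L * norm (y - z)"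
  obtains y where "y 0 = y0"
    "\<And>t. t \<in> {-T..T} \<Longrightarrow> (y has_vector_derivative f t (y t)) (at t within {-T..T})"
proof -
  \<comment> \<open>Clamping time turns functions on the interval into bounded continuous functions
    on the whole line, which form a complete metric space as a type.\<close>
  define cl where "cl t = max (-T) (min T t)" for t
  have cl: "cl t \<in> {-T..T}" for t using T by (auto simp: cl_def)
  have cl_id: "cl t = t" if "t \<in> {-T..T}" for t using that by (auto simp: cl_def)
  define I where "I u t = integral {-T..t} (\<lambda>s. f s (u s))" for u :: "real \<Rightarrow> 'b" and t
  have I: "(I u has_vector_derivative f t (u t)) (at t within {-T..T})"
    if "continuous_on {-T..T} u" "t \<in> {-T..T}" for u t
    unfolding I_def using integral_has_vector_derivative[OF cont[OF that(1)] that(2)] .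
  \<comment> \<open>The integral \<open>I\<close> starts at -T; subtracting \<open>I u 0\<close>
    moves the initial condition to time 0.\<close>
  define Op where "Op u t = y0 + I u (cl t) - I u 0" for u t
  have Op_mem: "Op u \<in> bcontfun" if u: "continuous_on {-T..T} u" for u
  proof -
    have "continuous_on {-T..T} (I u)"
      using I[OF u] by (rule continuous_on_vector_derivative)
    moreover have cl_cont: "continuous_on UNIV cl" unfolding cl_def by (intro continuous_intros)
    ultimately have c: "continuous_on UNIV (\<lambda>t. I u (cl t))"
      using cl by (intro continuous_on_compose2[of "{-T..T}" "I u" UNIV cl]) auto
    have "compact (I u ` {-T..T})"
      using \<open>continuous_on {-T..T} (I u)\<close> by (intro compact_continuous_image) auto
    moreover have "range (\<lambda>t. I u (cl t)) \<subseteq> I u ` {-T..T}" using cl by auto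
    ultimately have "bounded (range (\<lambda>t. I u (cl t)))"
      using bounded_subset compact_imp_bounded by blast
    then obtain b where "\<And>t. norm (I u (cl t)) \<le> b" by (auto simp: bounded_iff)
    then have "norm (Op u t) \<le> norm y0 + b + norm (I u 0)" for t
      unfolding Op_def by (smt (verit) norm_triangle_ineq norm_triangle_ineq4)
    then have "bounded (range (Op u))" by (auto simp: bounded_iff)
    moreover have "continuous_on UNIV (Op u)" unfolding Op_def by (intro continuous_intros c)
    ultimately show ?thesis by (simp add: bcontfun_def)
  qed
  define P where "P u = Bcontfun (Op (apply_bcontfun u))" for u :: "real \<Rightarrow>\<^sub>C 'b"
  have P: "apply_bcontfun (P u) = Op (apply_bcontfun u)" for u
    unfolding P_def by (simp add: Bcontfun_inverse Op_mem)
  have "dist (P u) (P v) \<le> 1/2 * dist u v" for u v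
  proof (rule dist_bound)
    fix t
    have "norm ((I u (cl t) - I v (cl t)) - (I u 0 - I v 0)) \<le> (L * dist u v) * norm (cl t - 0)"
    proof (rule differentiable_bound[where S = "{-T..T}" and f' = "\<lambda>t x. x *\<^sub>R (f t (u t) - f t (v t))"])
      show "((\<lambda>t. I u t - I v t) has_derivative (\<lambda>x. x *\<^sub>R (f t (u t) - f t (v t)))) (at t within {-T..T})"
        if "t \<in> {-T..T}" for t
        using has_vector_derivative_diff[OF I[OF _ that] I[OF _ that], of u v]
        by (simp add: has_vector_derivative_def)
      show "onorm (\<lambda>x. x *\<^sub>R (f t (u t) - f t (v t))) \<le> L * dist u v" if t: "t \<in> {-T..T}" for t
      proof (rule onorm_scaleR_le)
        have "norm (f t (u t) - f t (v t)) \<le> L * norm (u t - v t)" by (rule lip[OF t])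
        also have "\<dots> \<le> L * dist u v"
          using dist_bounded[of u t v] L by (intro mult_left_mono) (auto simp: dist_norm)
        finally show "norm (f t (u t) - f t (v t)) \<le> L * dist u v" .
      qed
    qed (use cl T in auto)
    also have "\<dots> \<le> (L * dist u v) * T" using cl[of t] L by (intro mult_left_mono) auto
    also have "\<dots> = (T * L) * dist u v" by simp
    also have "\<dots> \<le> 1/2 * dist u v" using T by (intro mult_right_mono) auto
    finally show "dist (P u t) (P v t) \<le> 1/2 * dist u v"
      unfolding P Op_def dist_norm by (simp add: algebra_simps)
  qed
  then obtain u where "P u = u" using banach_fix_type[of "1/2" P] by auto
  then have u: "apply_bcontfun u = Op (apply_bcontfun u)" using P[of u] by simp
  show thesis
  proof
    show "u 0 = y0" using T by (subst u) (simp add: Op_def cl_def)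
    fix t assume t: "t \<in> {-T..T}"
    have "((\<lambda>t. y0 + I u t - I u 0) has_vector_derivative f t (u t)) (at t within {-T..T})"
      using I[OF _ t, of u] by (auto intro!: derivative_eq_intros)
    then show "(apply_bcontfun u has_vector_derivative f t (u t)) (at t within {-T..T})"
      by (rule has_vector_derivative_transform[OF t, rotated])
        (subst u, simp add: Op_def cl_id)
  qed
qed

text \<open>C^1 regularity is available only as continuity of the derivative in each fixed
  direction. The sum over the basis is a continuous function that controls the operator
  norm.\<close>

lemma onorm_le_sum_Basis:
  fixes f :: "'e::euclidean_space \<Rightarrow> 'f::real_normed_vector"
  assumes "bounded_linear f"
  shows "onorm f \<le> (\<Sum>i\<in>Basis. norm (f i))"
proof (rule onorm_le)
  interpret f: bounded_linear f by fact
  fix v :: 'e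
  have "f v = (\<Sum>i\<in>Basis. (v \<bullet> i) *\<^sub>R f i)"
    by (subst euclidean_representation[of v, symmetric]) (simp only: f.sum f.scaleR)
  also have "norm \<dots> \<le> (\<Sum>i\<in>Basis. norm (f i) * norm v)"
    by (intro sum_norm_le) (simp add: Basis_le_norm mult.commute[of "norm (f _)"] mult_right_mono)
  finally show "norm (f v) \<le> (\<Sum>i\<in>Basis. norm (f i)) * norm v" by (simp add: sum_distrib_right)
qed

section \<open>Uniqueness and the differentiable local flow of a C^1 field\<close>

locale C1_field =
  fixes Y :: "'e::euclidean_space \<Rightarrow> 'e" and U :: "'e set"
  assumes open_U: "open U"
    and C1: "Ck_on 1 Y U"
begin

abbreviation DY where "DY x \<equiv> frechet_derivative Y (at x)"

lemma DY: "x \<in> U \<Longrightarrow> (Y has_derivative DY x) (at x)"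
  using C1 by (simp add: frechet_derivative_works)

lemma bounded_linear_DY: "x \<in> U \<Longrightarrow> bounded_linear (DY x)"
  using DY has_derivative_bounded_linear by blast

lemma continuous_DY: "continuous_on U (\<lambda>x. DY x v)"
  using C1 by simp

lemma bounds_on_cball:
  assumes "x0 \<in> U"
  obtains R L K where "0 < R" "0 \<le> L" "0 \<le> K" "cball x0 R \<subseteq> U"
    "\<And>x. x \<in> cball x0 R \<Longrightarrow> norm (Y x) \<le> K"
    "\<And>x v. x \<in> cball x0 R \<Longrightarrow> norm (DY x v) \<le> L * norm v"
    "\<And>x z. x \<in> cball x0 R \<Longrightarrow> z \<in> cball x0 R \<Longrightarrow> norm (Y x - Y z) \<le> L * norm (x - z)"
proof -
  obtain R where R: "0 < R" "cball x0 R \<subseteq> U"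
    using open_U assms open_contains_cball by blast
  have ne: "cball x0 R \<noteq> {}" using R by auto
  have "continuous_on (cball x0 R) (\<lambda>x. norm (Y x))"
    using DY R by (intro continuous_intros continuous_at_imp_continuous_on) (blast dest: has_derivative_continuous)
  then obtain k where K: "\<And>x. x \<in> cball x0 R \<Longrightarrow> norm (Y x) \<le> norm (Y k)"
    using continuous_attains_sup[OF compact_cball ne] by blast
  have "continuous_on (cball x0 R) (\<lambda>x. \<Sum>i\<in>Basis. norm (DY x i))"
    by (intro continuous_intros continuous_on_subset[OF continuous_DY R(2)])
  then obtain l where l: "\<And>x. x \<in> cball x0 R \<Longrightarrow> (\<Sum>i\<in>Basis. norm (DY x i)) \<le> (\<Sum>i\<in>Basis. norm (DY l i))"
    using continuous_attains_sup[OF compact_cball ne] by blast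
  define L where "L = (\<Sum>i\<in>Basis. norm (DY l i))"
  have on: "onorm (DY x) \<le> L" if "x \<in> cball x0 R" for x
    using onorm_le_sum_Basis[OF bounded_linear_DY] l[OF that] that R L_def by (meson order_trans subsetD)
  show thesis
  proof (rule that[of R L "norm (Y k)"])
    show "norm (DY x v) \<le> L * norm v" if "x \<in> cball x0 R" for x v
      using onorm[OF bounded_linear_DY, of x v] on[OF that] that R
      by (meson mult_right_mono norm_ge_zero order_trans subsetD)
    show "norm (Y x - Y z) \<le> L * norm (x - z)" if "x \<in> cball x0 R" "z \<in> cball x0 R" for x z
      using that on R
      by (intro differentiable_bound[where S = "cball x0 R" and f' = DY])
        (blast intro: has_derivative_at_withinI DY convex_cball)+
  qed (use R K in \<open>auto simp: L_def intro: sum_nonneg\<close>)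
qed

text \<open>The function \<open>H\<close> bounds the variation of the derivative between two points
  and vanishes on the diagonal. Its uniform continuity on a compact product makes it at most
  \<open>e\<close> near the diagonal, and the mean value inequality along the segment from
  \<open>x\<close> to \<open>z\<close> concludes.\<close>

lemma uniformly_differentiable:
  assumes "cball x0 R \<subseteq> U" "0 < e"
  obtains d where "0 < d" "\<And>x z. x \<in> cball x0 R \<Longrightarrow> z \<in> cball x0 R \<Longrightarrow> dist z x < d \<Longrightarrow>
    norm (Y z - Y x - DY x (z - x)) \<le> e * norm (z - x)"
proof -
  define H where "H p = (\<Sum>i\<in>Basis. norm (DY (snd p) i - DY (fst p) i))" for p
  have "continuous_on (cball x0 R \<times> cball x0 R) H"
    unfolding H_def
    by (intro continuous_intros continuous_on_compose2[OF continuous_DY]) (use assms in auto)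
  then have "uniformly_continuous_on (cball x0 R \<times> cball x0 R) H"
    by (intro compact_uniformly_continuous compact_Times) auto
  then obtain d where d: "0 < d" "\<And>p q. p \<in> cball x0 R \<times> cball x0 R \<Longrightarrow> q \<in> cball x0 R \<times> cball x0 R \<Longrightarrow>
      dist q p < d \<Longrightarrow> dist (H q) (H p) < e"
    using assms(2) unfolding uniformly_continuous_on_def by metis
  have H: "H (x, w) \<le> e" if "x \<in> cball x0 R" "w \<in> cball x0 R" "dist w x < d" for x w
    using d(2)[of "(x, x)" "(x, w)"] that by (simp add: H_def dist_Pair_Pair dist_real_def)
  show thesis
  proof (rule that[OF d(1)])
    fix x z assume x: "x \<in> cball x0 R" and z: "z \<in> cball x0 R" and xz: "dist z x < d"
    let ?S = "closed_segment x z"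
    have S: "?S \<subseteq> cball x0 R" using x z by (simp add: closed_segment_subset)
    have "norm (Y z - Y x - DY x (z - x)) \<le> norm (z - x) * e"
    proof (rule differentiable_bound_linearization[where S = ?S and f' = DY])
      show "x + t *\<^sub>R (z - x) \<in> ?S" if "t \<in> {0..1}" for t
        using that by (auto simp: in_segment algebra_simps intro!: exI[of _ t])
      show "(Y has_derivative DY w) (at w within ?S)" if "w \<in> ?S" for w
        using DY that S assms(1) by (blast intro: has_derivative_at_withinI)
      show "onorm (DY w - DY x) \<le> e" if w: "w \<in> ?S" for w
      proof -
        have "dist w x \<le> dist z x" using dist_in_closed_segment[OF w] by (simp add: dist_commute)
        then have "H (x, w) \<le> e" using H x w S xz by auto
        moreover have "onorm (\<lambda>v. DY w v - DY x v) \<le> H (x, w)"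
          unfolding H_def fst_conv snd_conv
          by (intro onorm_le_sum_Basis bounded_linear_sub bounded_linear_DY) (use w S x assms(1) in auto)
        ultimately show ?thesis by (simp add: fun_diff_def)
      qed
    qed auto
    then show "norm (Y z - Y x - DY x (z - x)) \<le> e * norm (z - x)" by (simp add: mult.commute)
  qed
qed

text \<open>The short-interval estimate is applied to the difference of the two curves, with error
  term 0 and initial value 0.\<close>

lemma local_uniqueness:
  assumes "open J" "t0 \<in> J" "u t0 = v t0" "u t0 \<in> U"
    and u: "\<And>t. t \<in> J \<Longrightarrow> (u has_vector_derivative Y (u t)) (at t)"
    and v: "\<And>t. t \<in> J \<Longrightarrow> (v has_vector_derivative Y (v t)) (at t)"
  shows "\<forall>\<^sub>F t in nhds t0. u t = v t"
proof -
  obtain R L K where R: "0 < R" and L: "0 \<le> L"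
    and lip: "\<And>x z. x \<in> cball (u t0) R \<Longrightarrow> z \<in> cball (u t0) R \<Longrightarrow> norm (Y x - Y z) \<le> L * norm (x - z)"
    using bounds_on_cball[OF assms(4)] by metis
  have "isCont u t0" "isCont v t0"
    using u v assms(2) by (blast intro: has_vector_derivative_continuous)+
  then have "\<forall>\<^sub>F t in nhds t0. dist (u t) (u t0) < R" "\<forall>\<^sub>F t in nhds t0. dist (v t) (v t0) < R"
    using R by (auto simp: isCont_def dest!: tendstoD[OF _ R] tendsto_at_iff_tendsto_nhds[THEN iffD1])
  moreover have "\<forall>\<^sub>F t in nhds t0. t \<in> J" using assms(1,2) by (rule eventually_nhds_in_open)
  ultimately have "\<forall>\<^sub>F t in nhds t0. dist (u t) (u t0) < R \<and> dist (v t) (v t0) < R \<and> t \<in> J"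
    by eventually_elim auto
  then obtain d where d: "0 < d" "\<And>t. dist t t0 < d \<Longrightarrow> dist (u t) (u t0) < R \<and> dist (v t) (v t0) < R \<and> t \<in> J"
    unfolding eventually_nhds_metric by metis
  \<comment> \<open>The first bound keeps both curves in the ball with the Lipschitz estimate; the
    second yields T L <= 1/2, with L + 1 to avoid division by zero.\<close>
  define T where "T = min (d/2) (1 / (2 * (L + 1)))"
  have T: "0 < T" "T * L \<le> 1/2" "T < d"
  proof -
    have "T * L \<le> 1 / (2 * (L + 1)) * L" using L by (intro mult_right_mono) (auto simp: T_def)
    also have "\<dots> \<le> 1/2" using L by (simp add: field_simps)
    finally show "T * L \<le> 1/2" .
  qed (use d L in \<open>auto simp: T_def\<close>)
  have J: "t0 + s \<in> J" "u (t0 + s) \<in> cball (u t0) R" "v (t0 + s) \<in> cball (u t0) R" if "s \<in> {-T..T}" for s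
    using d(2)[of "t0 + s"] that T assms(3) by (auto simp: dist_real_def dist_commute less_imp_le)
  have "u t = v t" if "dist t t0 < T" for t
  proof -
    have "norm (u (t0 + (t - t0)) - v (t0 + (t - t0))) \<le> 2 * (norm (u (t0 + 0) - v (t0 + 0)) + T * 0)"
    proof (rule norm_le_on_short_interval[where y = "\<lambda>s. u (t0 + s) - v (t0 + s)"
          and y' = "\<lambda>s. Y (u (t0 + s)) - Y (v (t0 + s))" and L = L])
      fix s assume s: "s \<in> {-T..T}"
      have sh: "((\<lambda>s. t0 + s) has_vector_derivative 1) (at s within {-T..T})"
        by (auto intro!: derivative_eq_intros)
      have "((\<lambda>s. w (t0 + s)) has_vector_derivative Y (w (t0 + s))) (at s within {-T..T})"
        if "\<And>t. t \<in> J \<Longrightarrow> (w has_vector_derivative Y (w t)) (at t)" for w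
        using vector_diff_chain_within[OF sh has_vector_derivative_at_within[OF that[OF J(1)[OF s]]]]
        by (simp add: o_def)
      then show "((\<lambda>s. u (t0 + s) - v (t0 + s)) has_vector_derivative Y (u (t0 + s)) - Y (v (t0 + s)))
          (at s within {-T..T})"
        using u v by (intro has_vector_derivative_diff) auto
      show "norm (Y (u (t0 + s)) - Y (v (t0 + s))) \<le> L * norm (u (t0 + s) - v (t0 + s)) + 0"
        using lip J s by simp
    qed (use T L that in \<open>auto simp: dist_real_def\<close>)
    then show ?thesis using assms(3) by simp
  qed
  then show ?thesis using T(1) by (auto simp: eventually_nhds_metric)
qed

lemma solution_in_cball:
  fixes y :: "real \<Rightarrow> 'e"
  assumes "0 \<le> T" "T * K \<le> R" "0 \<le> K"
    and der: "\<And>t. t \<in> {-T..T} \<Longrightarrow> (y has_vector_derivative y' t) (at t within {-T..T})"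
    and bound: "\<And>t. t \<in> {-T..T} \<Longrightarrow> norm (y' t) \<le> K"
    and t: "t \<in> {-T..T}"
  shows "y t \<in> cball (y 0) R"
proof -
  have "norm (y t - y 0) \<le> K * norm (t - 0)"
  proof (rule differentiable_bound[where S = "{-T..T}" and f' = "\<lambda>t x. x *\<^sub>R y' t"])
    show "(y has_derivative (\<lambda>x. x *\<^sub>R y' t)) (at t within {-T..T})" if "t \<in> {-T..T}" for t
      using der[OF that] by (simp add: has_vector_derivative_def)
    show "onorm (\<lambda>x. x *\<^sub>R y' t) \<le> K" if "t \<in> {-T..T}" for t
      using bound[OF that] by (rule onorm_scaleR_le)
  qed (use assms t in auto)
  also have "\<dots> \<le> K * T" using t assms by (intro mult_left_mono) auto
  finally show ?thesis using assms by (simp add: dist_norm norm_minus_commute mult.commute)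
qed

text \<open>The derivative \<open>M t\<close> of the flow in the initial condition solves the variational equation
  along the trajectory of \<open>x0\<close>.\<close>

lemma local_flow:
  assumes x0: "x0 \<in> U"
  obtains T r \<phi> M where "0 < T" "0 < r"
    and "\<And>x. x \<in> ball x0 r \<Longrightarrow> \<phi> 0 x = x"
    and "\<And>x t. x \<in> ball x0 r \<Longrightarrow> t \<in> {-T<..<T} \<Longrightarrow> \<phi> t x \<in> U"
    and "\<And>x t. x \<in> ball x0 r \<Longrightarrow> t \<in> {-T<..<T} \<Longrightarrow>
      ((\<lambda>s. \<phi> s x) has_vector_derivative Y (\<phi> t x)) (at t)"
    and "\<And>t. t \<in> {-T<..<T} \<Longrightarrow> (\<phi> t has_derivative M t) (at x0)"
    and "\<And>w. M 0 w = w"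
    and "\<And>w. ((\<lambda>t. M t w) has_vector_derivative DY x0 w) (at 0)"
proof -
  obtain R L K where R: "0 < R" "0 \<le> L" "0 \<le> K" and RU: "cball x0 R \<subseteq> U"
    and YK: "\<And>x. x \<in> cball x0 R \<Longrightarrow> norm (Y x) \<le> K"
    and DYL: "\<And>x v. x \<in> cball x0 R \<Longrightarrow> norm (DY x v) \<le> L * norm v"
    and lip: "\<And>x z. x \<in> cball x0 R \<Longrightarrow> z \<in> cball x0 R \<Longrightarrow> norm (Y x - Y z) \<le> L * norm (x - z)"
    using bounds_on_cball[OF x0] by metis
  \<comment> \<open>With speed at most \<open>K\<close>, a curve that starts in the ball of radius
    R/2 cannot leave the ball of radius R within time T. The second bound is the contraction
    condition.\<close>
  define T where "T = min (R / (2 * (K + 1))) (1 / (2 * (L + 1)))"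
  have T: "0 < T" "T * L \<le> 1/2" "T * K \<le> R/2"
  proof -
    have "T * L \<le> 1 / (2 * (L + 1)) * L" using R by (intro mult_right_mono) (auto simp: T_def)
    also have "\<dots> \<le> 1/2" using R by (simp add: field_simps)
    finally show "T * L \<le> 1/2" .
    have "T * K \<le> R / (2 * (K + 1)) * K" using R by (intro mult_right_mono) (auto simp: T_def)
    also have "\<dots> \<le> R/2" using R by (simp add: field_simps)
    finally show "T * K \<le> R/2" .
  qed (use R in \<open>auto simp: T_def\<close>)
  let ?B = "cball x0 R" and ?I = "{-T..T}"
  have "\<exists>y. y 0 = x \<and> (\<forall>t\<in>?I. y t \<in> ?B \<and> (y has_vector_derivative Y (y t)) (at t within ?I))"
    if x: "x \<in> cball x0 (R/2)" for x
  proof -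
    \<comment> \<open>The nearest-point projection is 1-Lipschitz, so Y composed with
      \<open>p\<close> is Lipschitz on the whole space. Its solution stays in the ball, where
      \<open>p\<close> is the identity, and hence solves the original equation.\<close>
    define p where "p = closest_point ?B"
    have p: "p z \<in> ?B" for z
      unfolding p_def using R by (intro closest_point_in_set) auto
    have plip: "dist (p a) (p b) \<le> dist a b" for a b
      unfolding p_def using R by (intro closest_point_lipschitz) auto
    have pcont: "continuous_on UNIV p"
      unfolding p_def using R by (intro continuous_on_closest_point) auto
    obtain y where y0: "y 0 = x"
      and y: "\<And>t. t \<in> ?I \<Longrightarrow> (y has_vector_derivative Y (p (y t))) (at t within ?I)"
    proof (rule picard_lindelof[OF T(1,2) R(2), of "\<lambda>t z. Y (p z)" x])
      show "norm (Y (p a) - Y (p b)) \<le> L * norm (a - b)" for a b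
        using lip[OF p p, of a b] mult_left_mono[OF plip R(2), of a b] by (simp add: dist_norm)
      fix u :: "real \<Rightarrow> 'e" assume u: "continuous_on ?I u"
      have "continuous_on ?B Y"
        using DY RU by (intro continuous_at_imp_continuous_on) (blast dest: has_derivative_continuous)
      moreover have "continuous_on ?I (\<lambda>t. p (u t))"
        using continuous_on_compose2[OF pcont u] by simp
      ultimately show "continuous_on ?I (\<lambda>t. Y (p (u t)))"
        by (rule continuous_on_compose2) (use p in auto)
    qed blast
    have "y t \<in> ?B" if t: "t \<in> ?I" for t
    proof -
      have "y t \<in> cball (y 0) (R/2)"
        by (rule solution_in_cball[OF _ T(3) R(3) y _ t]) (use T YK p in auto)
      moreover have "dist x0 (y t) \<le> dist x0 x + dist x (y t)" by (rule dist_triangle)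
      ultimately show ?thesis using x y0 by simp
    qed
    moreover from this have "p (y t) = y t" if "t \<in> ?I" for t
      unfolding p_def using that by (intro closest_point_self) auto
    ultimately show ?thesis using y0 y by metis
  qed
  then obtain \<gamma> where \<gamma>0: "\<And>x. x \<in> cball x0 (R/2) \<Longrightarrow> \<gamma> x 0 = x"
    and \<gamma>B: "\<And>x t. x \<in> cball x0 (R/2) \<Longrightarrow> t \<in> ?I \<Longrightarrow> \<gamma> x t \<in> ?B"
    and \<gamma>: "\<And>x t. x \<in> cball x0 (R/2) \<Longrightarrow> t \<in> ?I \<Longrightarrow>
      (\<gamma> x has_vector_derivative Y (\<gamma> x t)) (at t within ?I)"
    by metis
  have x0B: "x0 \<in> cball x0 (R/2)" using R by simp
  have \<gamma>lip: "norm (\<gamma> x t - \<gamma> z t) \<le> 2 * norm (x - z)"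
    if x: "x \<in> cball x0 (R/2)" and z: "z \<in> cball x0 (R/2)" and t: "t \<in> ?I" for x z t
  proof -
    have "norm (\<gamma> x t - \<gamma> z t) \<le> 2 * (norm (\<gamma> x 0 - \<gamma> z 0) + T * 0)"
    proof (rule norm_le_on_short_interval[where y = "\<lambda>s. \<gamma> x s - \<gamma> z s"
          and y' = "\<lambda>s. Y (\<gamma> x s) - Y (\<gamma> z s)", OF _ T(2) R(2) _ _ t])
      show "((\<lambda>s. \<gamma> x s - \<gamma> z s) has_vector_derivative Y (\<gamma> x s) - Y (\<gamma> z s)) (at s within ?I)"
        if "s \<in> ?I" for s
        by (intro has_vector_derivative_diff \<gamma> x z that)
      show "norm (Y (\<gamma> x s) - Y (\<gamma> z s)) \<le> L * norm (\<gamma> x s - \<gamma> z s) + 0" if "s \<in> ?I" for s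
        using lip[OF \<gamma>B[OF x that] \<gamma>B[OF z that]] by simp
    qed (use T in simp)
    then show ?thesis using \<gamma>0[OF x] \<gamma>0[OF z] by simp
  qed
  define a where "a = \<gamma> x0"
  have a: "a t \<in> ?B" "a t \<in> U" if "t \<in> ?I" for t
    using \<gamma>B[OF x0B that] RU by (auto simp: a_def)
  have a_cont: "continuous_on ?I a"
    unfolding a_def using \<gamma>[OF x0B] by (rule continuous_on_vector_derivative)
  have "\<exists>m. m 0 = w \<and> (\<forall>t\<in>?I. (m has_vector_derivative DY (a t) (m t)) (at t within ?I))" for w
  proof -
    obtain m where "m 0 = w"
      "\<And>t. t \<in> ?I \<Longrightarrow> (m has_vector_derivative DY (a t) (m t)) (at t within ?I)"
    proof (rule picard_lindelof[OF T(1,2) R(2), of "\<lambda>t. DY (a t)" w])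
      show "norm (DY (a t) y - DY (a t) z) \<le> L * norm (y - z)" if "t \<in> ?I" for t y z
        using DYL[OF a(1)[OF that], of "y - z"] bounded_linear_DY[OF a(2)[OF that]]
        by (simp add: linear_diff bounded_linear.linear)
      fix u :: "real \<Rightarrow> 'e" assume u: "continuous_on ?I u"
      \<comment> \<open>Expanding \<open>u t\<close> in the basis reduces joint continuity of the
        derivative to continuity in fixed directions.\<close>
      have "continuous_on ?I (\<lambda>t. \<Sum>i\<in>Basis. (u t \<bullet> i) *\<^sub>R DY (a t) i)"
        by (intro continuous_intros u continuous_on_compose2[OF continuous_DY a_cont]) (use a in auto)
      moreover have "(\<Sum>i\<in>Basis. (u t \<bullet> i) *\<^sub>R DY (a t) i) = DY (a t) (u t)" if "t \<in> ?I" for t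
      proof -
        interpret bounded_linear "DY (a t)" by (rule bounded_linear_DY[OF a(2)[OF that]])
        show ?thesis
          using arg_cong[OF euclidean_representation[of "u t"], of "DY (a t)"] by (simp only: sum scaleR)
      qed
      ultimately show "continuous_on ?I (\<lambda>t. DY (a t) (u t))" by (rule continuous_on_eq)
    qed blast
    then show ?thesis by blast
  qed
  then obtain m where m0: "\<And>w. m w 0 = w"
    and m: "\<And>w t. t \<in> ?I \<Longrightarrow> (m w has_vector_derivative DY (a t) (m w t)) (at t within ?I)"
    by metis
  have lin: "bounded_linear (\<lambda>w. m w t)" if t: "t \<in> ?I" for t
  proof -
    \<comment> \<open>Linearity in the initial vector is uniqueness for the variational equation:
      the deviation from linearity solves the same equation with initial value 0.\<close>
    have *: "norm (m (b *\<^sub>R v + c *\<^sub>R w) t - (b *\<^sub>R m v t + c *\<^sub>R m w t)) \<le>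
        2 * (norm (m (b *\<^sub>R v + c *\<^sub>R w) 0 - (b *\<^sub>R m v 0 + c *\<^sub>R m w 0)) + T * 0)" for b c v w
    proof (rule norm_le_on_short_interval[where y = "\<lambda>s. m (b *\<^sub>R v + c *\<^sub>R w) s - (b *\<^sub>R m v s + c *\<^sub>R m w s)"
          and y' = "\<lambda>s. DY (a s) (m (b *\<^sub>R v + c *\<^sub>R w) s) - (b *\<^sub>R DY (a s) (m v s) + c *\<^sub>R DY (a s) (m w s))",
          OF _ T(2) R(2) _ _ t])
      fix s assume s: "s \<in> ?I"
      show "((\<lambda>s. m (b *\<^sub>R v + c *\<^sub>R w) s - (b *\<^sub>R m v s + c *\<^sub>R m w s)) has_vector_derivative
          DY (a s) (m (b *\<^sub>R v + c *\<^sub>R w) s) - (b *\<^sub>R DY (a s) (m v s) + c *\<^sub>R DY (a s) (m w s)))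
          (at s within ?I)"
        using m[OF s] by (intro has_vector_derivative_diff has_vector_derivative_add
          bounded_linear.has_vector_derivative[OF bounded_linear_scaleR_right])
      interpret bounded_linear "DY (a s)" by (rule bounded_linear_DY[OF a(2)[OF s]])
      show "norm (DY (a s) (m (b *\<^sub>R v + c *\<^sub>R w) s) - (b *\<^sub>R DY (a s) (m v s) + c *\<^sub>R DY (a s) (m w s)))
          \<le> L * norm (m (b *\<^sub>R v + c *\<^sub>R w) s - (b *\<^sub>R m v s + c *\<^sub>R m w s)) + 0"
        using DYL[OF a(1)[OF s], of "m (b *\<^sub>R v + c *\<^sub>R w) s - (b *\<^sub>R m v s + c *\<^sub>R m w s)"]
        by (simp add: diff add scaleR)
    qed (use T in simp)
    have comb: "m (b *\<^sub>R v + c *\<^sub>R w) t = b *\<^sub>R m v t + c *\<^sub>R m w t" for b c v w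
      using *[of b v c w] by (simp add: m0)
    have "linear (\<lambda>w. m w t)"
      by (rule linearI) (use comb[of 1 _ 1] comb[of _ _ 0 0] in auto)
    then show ?thesis by (simp add: linear_conv_bounded_linear)
  qed
  have der: "((\<lambda>x. \<gamma> x t) has_derivative (\<lambda>w. m w t)) (at x0)" if t: "t \<in> ?I" for t
    unfolding has_derivative_at_alt
  proof (intro conjI allI impI lin[OF t])
    fix e :: real assume e: "0 < e"
    \<comment> \<open>The error term below is 2 T e' times the Lipschitz bound 2 |z - x0|, that is,
      4 T e' |z - x0|. The same factor 2 explains the radius d/2 chosen for
      \<open>z\<close>.\<close>
    define e' where "e' = e / (4 * T)"
    have e': "0 < e'" using e T by (simp add: e'_def)
    obtain d where d: "0 < d" and ud: "\<And>x z. x \<in> ?B \<Longrightarrow> z \<in> ?B \<Longrightarrow> dist z x < d \<Longrightarrow>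
        norm (Y z - Y x - DY x (z - x)) \<le> e' * norm (z - x)"
      using uniformly_differentiable[OF RU e'] by metis
    have "norm (\<gamma> z t - \<gamma> x0 t - m (z - x0) t) \<le> e * norm (z - x0)"
      if z: "norm (z - x0) < min (R/2) (d/2)" for z
    proof -
      have zB: "z \<in> cball x0 (R/2)" using z by (simp add: dist_norm norm_minus_commute)
      have "norm (\<gamma> z t - a t - m (z - x0) t) \<le>
          2 * (norm (\<gamma> z 0 - a 0 - m (z - x0) 0) + T * (e' * (2 * norm (z - x0))))"
      proof (rule norm_le_on_short_interval[where y = "\<lambda>s. \<gamma> z s - a s - m (z - x0) s"
            and y' = "\<lambda>s. Y (\<gamma> z s) - Y (a s) - DY (a s) (m (z - x0) s)", OF _ T(2) R(2) _ _ t])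
        fix s assume s: "s \<in> ?I"
        show "((\<lambda>s. \<gamma> z s - a s - m (z - x0) s) has_vector_derivative
            Y (\<gamma> z s) - Y (a s) - DY (a s) (m (z - x0) s)) (at s within ?I)"
          unfolding a_def by (intro has_vector_derivative_diff \<gamma> zB x0B m[OF s, unfolded a_def] s)
        interpret bounded_linear "DY (a s)" by (rule bounded_linear_DY[OF a(2)[OF s]])
        have za: "norm (\<gamma> z s - a s) \<le> 2 * norm (z - x0)"
          unfolding a_def by (rule \<gamma>lip[OF zB x0B s])
        \<comment> \<open>The linearization at \<open>a s\<close> is added and subtracted: one
          summand is linear in the quantity being estimated, the other is the remainder controlled
          by \<open>ud\<close>.\<close>
        have "Y (\<gamma> z s) - Y (a s) - DY (a s) (m (z - x0) s) =
            DY (a s) (\<gamma> z s - a s - m (z - x0) s) + (Y (\<gamma> z s) - Y (a s) - DY (a s) (\<gamma> z s - a s))"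
          by (simp add: diff)
        also have "norm \<dots> \<le> L * norm (\<gamma> z s - a s - m (z - x0) s) + e' * norm (\<gamma> z s - a s)"
        proof (rule norm_triangle_mono[OF DYL[OF a(1)[OF s]] ud[OF a(1)[OF s] \<gamma>B[OF zB s]]])
          show "dist (\<gamma> z s) (a s) < d" using za z by (simp add: dist_norm)
        qed
        also have "\<dots> \<le> L * norm (\<gamma> z s - a s - m (z - x0) s) + e' * (2 * norm (z - x0))"
          using za e' by (intro add_left_mono mult_left_mono) auto
        finally show "norm (Y (\<gamma> z s) - Y (a s) - DY (a s) (m (z - x0) s)) \<le>
            L * norm (\<gamma> z s - a s - m (z - x0) s) + e' * (2 * norm (z - x0))" .
      qed (use T in simp)
      also have "\<dots> = 4 * T * e' * norm (z - x0)" using \<gamma>0[OF zB] \<gamma>0[OF x0B] m0 by (simp add: a_def)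
      also have "\<dots> = e * norm (z - x0)" using T by (simp add: e'_def)
      finally show ?thesis by (simp add: a_def)
    qed
    then show "\<exists>d>0. \<forall>y. norm (y - x0) < d \<longrightarrow>
        norm (\<gamma> y t - \<gamma> x0 t - m (y - x0) t) \<le> e * norm (y - x0)"
      using R d by (intro exI[of _ "min (R/2) (d/2)"]) auto
  qed
  have within: "at t within ?I = at t" if "t \<in> {-T<..<T}" for t
    using that by (intro at_within_interior) simp
  show thesis
  proof (rule that[of T "R/2" "\<lambda>t x. \<gamma> x t" "\<lambda>t w. m w t"])
    have "a 0 = x0" using \<gamma>0[OF x0B] by (simp add: a_def)
    then show "(m w has_vector_derivative DY x0 w) (at 0)" for w
      using m[of 0 w] T within[of 0] by (simp add: m0)
    show "((\<lambda>s. \<gamma> x s) has_vector_derivative Y (\<gamma> x t)) (at t)"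
      if "x \<in> ball x0 (R/2)" "t \<in> {-T<..<T}" for x t
      using \<gamma>[of x t] that within[of t] by simp
    show "\<gamma> x t \<in> U" if "x \<in> ball x0 (R/2)" "t \<in> {-T<..<T}" for x t
      using \<gamma>B[of x t] that RU by auto
  qed (use T R der m0 \<gamma>0 in auto)
qed

end

section \<open>Manifolds in coordinates\<close>

locale smooth_manifold =
  fixes A :: "('a::{t2_space, second_countable_topology}, 'e::euclidean_space) chart set"
  assumes atlas: "smooth_atlas A"
begin

lemma open_chart_domain: "c \<in> A \<Longrightarrow> open (fst c)"
  and open_chart_range: "c \<in> A \<Longrightarrow> open (chart_range c)"
  and homeomorphism_chart: "c \<in> A \<Longrightarrow> homeomorphism (fst c) (chart_range c) (snd c) (chart_inv c)"
  using atlas by (auto simp: smooth_atlas_def)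

lemma chart_inv_chart: "c \<in> A \<Longrightarrow> p \<in> fst c \<Longrightarrow> chart_inv c (snd c p) = p"
  using homeomorphism_chart homeomorphism_apply1 by blast

lemma chart_chart_inv: "x \<in> chart_range c \<Longrightarrow> snd c (chart_inv c x) = x"
  by (rule f_inv_into_f)

lemma chart_inv_mem: "x \<in> chart_range c \<Longrightarrow> chart_inv c x \<in> fst c"
  by (rule inv_into_into)

lemma charts_atD: "c \<in> charts_at A p \<Longrightarrow> c \<in> A" "c \<in> charts_at A p \<Longrightarrow> p \<in> fst c"
  by (auto simp: charts_at_def)

lemma chart_inv_at: "c \<in> A \<Longrightarrow> x \<in> chart_range c \<Longrightarrow> c \<in> charts_at A (chart_inv c x)"
  by (auto simp: charts_at_def inv_into_into)

lemma charts_at_range: "c \<in> charts_at A p \<Longrightarrow> snd c p \<in> chart_range c"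
  by (auto simp: charts_at_def)

lemma charts_at_inv: "c \<in> charts_at A p \<Longrightarrow> chart_inv c (snd c p) = p"
  using chart_inv_chart charts_atD by blast

lemma some_chart: "(SOME c. c \<in> charts_at A p) \<in> charts_at A p"
proof -
  have "p \<in> (\<Union>c\<in>A. fst c)" using atlas by (simp add: smooth_atlas_def)
  then have "\<exists>c. c \<in> charts_at A p" by (auto simp: charts_at_def)
  then show ?thesis by (rule someI_ex)
qed

lemma isCont_chart_inv: "c \<in> A \<Longrightarrow> x \<in> chart_range c \<Longrightarrow> isCont (chart_inv c) x"
  using homeomorphism_chart homeomorphism_cont2 open_chart_range continuous_on_eq_continuous_at by metis

lemma open_chart_image:
  assumes "c \<in> A" "open V"
  shows "open (snd c ` (fst c \<inter> V))"
proof -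
  have "snd c ` (fst c \<inter> V) = chart_range c \<inter> chart_inv c -` V"
  proof (intro equalityI subsetI)
    show "x \<in> snd c ` (fst c \<inter> V)" if "x \<in> chart_range c \<inter> chart_inv c -` V" for x
      using that chart_chart_inv[of x c] chart_inv_mem[of x c]
      by (intro image_eqI[of _ _ "chart_inv c x"]) auto
  qed (use chart_inv_chart[OF assms(1)] in auto)
  then show ?thesis
    using continuous_open_preimage[OF homeomorphism_cont2[OF homeomorphism_chart[OF assms(1)]]
        open_chart_range assms(2)] assms(1) by simp
qed

definition transition where
  "transition b c p = frechet_derivative (snd c \<circ> chart_inv b) (at (snd b p))"

lemma has_derivative_transition:
  assumes "b \<in> charts_at A p" "c \<in> charts_at A p"
  shows "(snd c \<circ> chart_inv b has_derivative transition b c p) (at (snd b p))"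
proof -
  have "smooth_on (snd c \<circ> chart_inv b) (snd b ` (fst b \<inter> fst c))"
    using atlas assms by (simp add: smooth_atlas_def charts_at_def)
  then show ?thesis
    unfolding transition_def using assms
    by (intro smooth_on_has_derivative) (auto simp: charts_at_def)
qed

text \<open>The chain rule through a transition map, valid near the point. The cocycle rule for
  \<open>transition\<close> and the chart independence of \<open>diff_fun\<close> and
  \<open>diff_map\<close> all come from it.\<close>

lemma has_derivative_change_chart:
  assumes b: "b \<in> charts_at A p" and c: "c \<in> charts_at A p"
    and f: "(f \<circ> chart_inv b has_derivative D) (at (snd b p))"
  shows "(f \<circ> chart_inv c has_derivative D \<circ> transition c b p) (at (snd c p))"
proof -
  have cA: "c \<in> A" and bA: "b \<in> A" using b c charts_atD by auto
  have "((f \<circ> chart_inv b) \<circ> (snd b \<circ> chart_inv c) has_derivative D \<circ> transition c b p) (at (snd c p))"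
    using f charts_at_inv[OF c] by (intro diff_chain_at has_derivative_transition b c) simp
  then show ?thesis
  proof (rule has_derivative_transform_within_open)
    show "open (snd c ` (fst c \<inter> fst b))" by (intro open_chart_image open_chart_domain cA bA)
    show "snd c p \<in> snd c ` (fst c \<inter> fst b)" using b c charts_atD by auto
    show "((f \<circ> chart_inv b) \<circ> (snd b \<circ> chart_inv c)) x = (f \<circ> chart_inv c) x"
      if "x \<in> snd c ` (fst c \<inter> fst b)" for x
      using that chart_inv_chart[OF cA] chart_inv_chart[OF bA] by auto
  qed
qed

lemma transition_trans:
  assumes "b \<in> charts_at A p" "c \<in> charts_at A p" "d \<in> charts_at A p"
  shows "transition c d p (transition b c p v) = transition b d p v"
proof -
  have "transition b d p = transition c d p \<circ> transition b c p"
    by (rule has_derivative_unique[OF has_derivative_transition[OF assms(1,3)]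
          has_derivative_change_chart[OF assms(2,1) has_derivative_transition[OF assms(2,3)]]])
  then show ?thesis by simp
qed

lemma transition_self:
  assumes "c \<in> charts_at A p"
  shows "transition c c p v = v"
proof -
  have "((\<lambda>x. x) has_derivative transition c c p) (at (snd c p))"
    using has_derivative_transition[OF assms assms]
  proof (rule has_derivative_transform_within_open)
    show "open (chart_range c)" by (rule open_chart_range[OF charts_atD(1)[OF assms]])
    show "snd c p \<in> chart_range c" by (rule charts_at_range[OF assms])
  qed (simp add: chart_chart_inv)
  then have "transition c c p = (\<lambda>x. x)" by (rule has_derivative_unique) (rule has_derivative_ident)
  then show ?thesis by simp
qed

lemma bounded_linear_transition:
  "b \<in> charts_at A p \<Longrightarrow> c \<in> charts_at A p \<Longrightarrow> bounded_linear (transition b c p)"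
  using has_derivative_transition has_derivative_bounded_linear by blast

subsection \<open>Tangent vectors in coordinates\<close>

lemma tangent_transition:
  "v \<in> tangent_space A p \<Longrightarrow> b \<in> charts_at A p \<Longrightarrow> c \<in> charts_at A p \<Longrightarrow> v c = transition b c p (v b)"
  unfolding tangent_space_def transition_def by blast

lemma tangent_eq_0: "v \<in> tangent_space A p \<Longrightarrow> c \<notin> charts_at A p \<Longrightarrow> v c = 0"
  unfolding tangent_space_def by blast

lemma tangent_spaceI:
  assumes "\<And>b c. b \<in> charts_at A p \<Longrightarrow> c \<in> charts_at A p \<Longrightarrow> v c = transition b c p (v b)"
    and "\<And>c. c \<notin> charts_at A p \<Longrightarrow> v c = 0"
  shows "v \<in> tangent_space A p"
  using assms unfolding tangent_space_def transition_def by blast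

lemma coord_vec_apply:
  "c \<in> charts_at A p \<Longrightarrow> b \<in> charts_at A p \<Longrightarrow> coord_vec A c p u b = transition c b p u"
  by (simp add: coord_vec_def transition_def)

lemma coord_vec_self [simp]: "c \<in> charts_at A p \<Longrightarrow> coord_vec A c p u c = u"
  by (simp add: coord_vec_apply transition_self)

lemma coord_vec_tangent: "c \<in> charts_at A p \<Longrightarrow> coord_vec A c p u \<in> tangent_space A p"
  by (rule tangent_spaceI) (simp add: coord_vec_apply transition_trans, simp add: coord_vec_def)

lemma tangent_eqI:
  assumes "v \<in> tangent_space A p" "w \<in> tangent_space A p" "c \<in> charts_at A p" "v c = w c"
  shows "v = w"
proof
  fix b
  show "v b = w b"
  proof (cases "b \<in> charts_at A p")
    case True
    then show ?thesis
      using tangent_transition[OF assms(1,3)] tangent_transition[OF assms(2,3)] assms(4) by simp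
  next
    case False
    then show ?thesis using assms tangent_eq_0 by metis
  qed
qed

lemma coord_vec_tangent_eq: "v \<in> tangent_space A p \<Longrightarrow> c \<in> charts_at A p \<Longrightarrow> coord_vec A c p (v c) = v"
  by (rule tangent_eqI[of _ p _ c]) (auto intro: coord_vec_tangent)

lemma subspace_tangent: "subspace (tangent_space A p)"
proof (rule subspaceI)
  note lin = bounded_linear_transition[THEN bounded_linear.linear]
  show "0 \<in> tangent_space A p" by (rule tangent_spaceI) (simp_all add: linear_0[OF lin])
  show "v + w \<in> tangent_space A p" if "v \<in> tangent_space A p" "w \<in> tangent_space A p" for v w
    by (rule tangent_spaceI)
      (simp_all add: linear_add[OF lin] tangent_eq_0[OF that(1)] tangent_eq_0[OF that(2)]
        tangent_transition[OF that(1), symmetric] tangent_transition[OF that(2), symmetric])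
  show "a *\<^sub>R v \<in> tangent_space A p" if "v \<in> tangent_space A p" for a v
    by (rule tangent_spaceI)
      (simp_all add: scaleR_fun_def linear_scale[OF lin] tangent_eq_0[OF that]
        tangent_transition[OF that, symmetric])
qed

lemma coord_vec_add:
  assumes "c \<in> charts_at A p"
  shows "coord_vec A c p (u + v) = coord_vec A c p u + coord_vec A c p v"
proof (rule tangent_eqI[OF _ _ assms])
  show "coord_vec A c p (u + v) c = (coord_vec A c p u + coord_vec A c p v) c"
    by (simp add: assms)
qed (intro coord_vec_tangent subspace_add[OF subspace_tangent] assms)+

lemma coord_vec_scaleR:
  assumes "c \<in> charts_at A p"
  shows "coord_vec A c p (a *\<^sub>R u) = a *\<^sub>R coord_vec A c p u"
proof (rule tangent_eqI[OF _ _ assms])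
  show "coord_vec A c p (a *\<^sub>R u) c = (a *\<^sub>R coord_vec A c p u) c"
    by (simp add: assms scaleR_fun_def)
qed (intro coord_vec_tangent subspace_scale[OF subspace_tangent] assms)+

text \<open>Linearity of \<open>f\<close> is known only on the tangent space, so \<open>f\<close> is
  composed with \<open>coord_vec A c p\<close> to obtain a linear map on the Euclidean
  model.\<close>

lemma linear_functional_coords:
  assumes f: "linear_functional_on (tangent_space A p) f" and c: "c \<in> charts_at A p"
    and v: "v \<in> tangent_space A p"
  shows "f v = (\<Sum>i\<in>Basis. (v c \<bullet> i) * f (coord_vec A c p i))"
proof -
  have lin: "linear (\<lambda>u. f (coord_vec A c p u))"
    using f coord_vec_tangent[OF c]
    by (intro linearI) (simp_all add: linear_functional_on_def coord_vec_add[OF c] coord_vec_scaleR[OF c])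
  have "f (coord_vec A c p (v c)) = f (coord_vec A c p (\<Sum>i\<in>Basis. (v c \<bullet> i) *\<^sub>R i))"
    by (simp only: euclidean_representation)
  also have "\<dots> = (\<Sum>i\<in>Basis. (v c \<bullet> i) * f (coord_vec A c p i))"
    unfolding linear_sum[OF lin] by (intro sum.cong refl) (simp add: linear_scale[OF lin])
  finally show ?thesis by (simp add: coord_vec_tangent_eq[OF v c])
qed

lemma cotangent_linear: "\<alpha> \<in> cotangent_space A p \<Longrightarrow> linear_functional_on (tangent_space A p) \<alpha>"
  by (simp add: cotangent_space_def)

lemma cotangent_add:
  "\<alpha> \<in> cotangent_space A p \<Longrightarrow> v \<in> tangent_space A p \<Longrightarrow> w \<in> tangent_space A p \<Longrightarrow> \<alpha> (v + w) = \<alpha> v + \<alpha> w"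
  and cotangent_scaleR:
  "\<alpha> \<in> cotangent_space A p \<Longrightarrow> v \<in> tangent_space A p \<Longrightarrow> \<alpha> (a *\<^sub>R v) = a * \<alpha> v"
  by (simp_all add: cotangent_space_def linear_functional_on_def)

lemma coord_covec_apply: "v \<in> tangent_space A p \<Longrightarrow> coord_covec A c p i v = v c \<bullet> i"
  by (simp add: coord_covec_def)

lemma coord_covec_cotangent: "coord_covec A c p i \<in> cotangent_space A p"
  using subspace_add[OF subspace_tangent] subspace_scale[OF subspace_tangent]
  by (auto simp: cotangent_space_def linear_functional_on_def coord_covec_def inner_add_left scaleR_fun_def)

text \<open>The coordinate covectors of one chart already separate tangent vectors. This is the
  uniqueness behind the definite description in \<open>sharp\<close>.\<close>

lemma cotangent_separates:
  assumes "v \<in> tangent_space A p" "w \<in> tangent_space A p"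
    and "\<And>\<beta>. \<beta> \<in> cotangent_space A p \<Longrightarrow> \<beta> v = \<beta> w"
  shows "v = w"
proof (rule tangent_eqI[OF assms(1,2) some_chart])
  let ?c = "SOME c. c \<in> charts_at A p"
  have "v ?c \<bullet> i = w ?c \<bullet> i" for i
    using assms(3)[OF coord_covec_cotangent[of ?c p i]] assms(1,2) by (simp add: coord_covec_apply)
  then show "v ?c = w ?c" by (simp add: euclidean_eq_iff[of "v ?c"])
qed

lemma sharp_eqI:
  assumes "v \<in> tangent_space A p" "\<And>\<beta>. \<beta> \<in> cotangent_space A p \<Longrightarrow> \<beta> v = B \<alpha> \<beta>"
  shows "sharp A p B \<alpha> = v"
  unfolding sharp_def
proof (rule the_equality)
  show "w = v" if "w \<in> tangent_space A p \<and> (\<forall>\<beta>\<in>cotangent_space A p. \<beta> w = B \<alpha> \<beta>)" for w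
    using cotangent_separates[of w p v] that assms by simp
qed (use assms in auto)

text \<open>For a covector with value 1 on \<open>v\<close> and 0 on \<open>w\<close> the result is
  \<open>w\<close>, which yields the Hamiltonian equation. In general it lies in the span of
  \<open>v\<close> and \<open>w\<close>, which bounds the rank.\<close>

lemma sharp_wedge:
  assumes "v \<in> tangent_space A p" "w \<in> tangent_space A p" "\<alpha> \<in> cotangent_space A p"
  shows "sharp A p (wedge v w) \<alpha> = \<alpha> v *\<^sub>R w - \<alpha> w *\<^sub>R v"
proof (rule sharp_eqI)
  have T: "a *\<^sub>R w \<in> tangent_space A p" "b *\<^sub>R v \<in> tangent_space A p" for a b
    using assms subspace_scale[OF subspace_tangent] by auto
  show "\<alpha> v *\<^sub>R w - \<alpha> w *\<^sub>R v \<in> tangent_space A p"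
    using T subspace_diff[OF subspace_tangent] by auto
  fix \<beta> assume \<beta>: "\<beta> \<in> cotangent_space A p"
  have "\<beta> (\<alpha> v *\<^sub>R w - \<alpha> w *\<^sub>R v) = \<beta> (\<alpha> v *\<^sub>R w + (- \<alpha> w) *\<^sub>R v)" by simp
  also have "\<dots> = \<alpha> v * \<beta> w - \<alpha> w * \<beta> v"
    by (simp only: cotangent_add[OF \<beta> T] cotangent_scaleR[OF \<beta> assms(1)] cotangent_scaleR[OF \<beta> assms(2)])
  finally show "\<beta> (\<alpha> v *\<^sub>R w - \<alpha> w *\<^sub>R v) = wedge v w \<alpha> \<beta>" by (simp add: wedge_def)
qed

subsection \<open>Differentials in coordinates\<close>

lemma smooth_fun_chart:
  assumes "smooth_fun A h" "c \<in> A"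
  shows "smooth_on (h \<circ> chart_inv c) (chart_range c)"
  using assms by (simp add: smooth_fun_def)

lemma diff_fun_coord:
  assumes "smooth_fun A h" "v \<in> tangent_space A p" "c \<in> charts_at A p"
  shows "diff_fun A h p v = frechet_derivative (h \<circ> chart_inv c) (at (snd c p)) (v c)"
proof -
  define b where "b = (SOME c. c \<in> charts_at A p)"
  have b: "b \<in> charts_at A p" unfolding b_def by (rule some_chart)
  have "(h \<circ> chart_inv c has_derivative frechet_derivative (h \<circ> chart_inv c) (at (snd c p))) (at (snd c p))"
    using assms by (intro smooth_on_has_derivative[OF smooth_fun_chart]) (auto simp: charts_at_def)
  from frechet_derivative_at[OF has_derivative_change_chart[OF assms(3) b this]]
  have "frechet_derivative (h \<circ> chart_inv b) (at (snd b p)) (v b)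
      = frechet_derivative (h \<circ> chart_inv c) (at (snd c p)) (transition b c p (v b))" by (metis o_apply)
  then show ?thesis
    using tangent_transition[OF assms(2) b assms(3)] assms(2) by (simp add: diff_fun_def b_def Let_def)
qed

lemma diff_fun_cotangent:
  assumes "smooth_fun A h"
  shows "diff_fun A h p \<in> cotangent_space A p"
proof -
  define c where "c = (SOME c. c \<in> charts_at A p)"
  have c: "c \<in> charts_at A p" unfolding c_def by (rule some_chart)
  interpret bounded_linear "frechet_derivative (h \<circ> chart_inv c) (at (snd c p))"
    using assms c
    by (intro has_derivative_bounded_linear[OF smooth_on_has_derivative[OF smooth_fun_chart]])
      (auto simp: charts_at_def)
  show ?thesis
    using subspace_add[OF subspace_tangent] subspace_scale[OF subspace_tangent]
    by (auto simp: cotangent_space_def linear_functional_on_def diff_fun_coord[OF assms _ c] add scaleR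
        scaleR_fun_def) (auto simp: diff_fun_def)
qed

text \<open>The map \<phi> represents \<open>F\<close> only near the base point, which is all that a
  local flow provides. The chain rule removes the arbitrary chart in
  \<open>diff_map\<close>.\<close>

lemma diff_map_coord:
  assumes b: "b \<in> charts_at A p" and c: "c \<in> charts_at A (F p)"
    and V: "open V" "snd b p \<in> V"
    and F: "\<And>x. x \<in> V \<Longrightarrow> F (chart_inv b x) = chart_inv c (\<phi> x)" "\<And>x. x \<in> V \<Longrightarrow> \<phi> x \<in> chart_range c"
    and \<phi>: "(\<phi> has_derivative D) (at (snd b p))" and v: "v \<in> tangent_space A p"
  shows "diff_map A F p v = coord_vec A c (F p) (D (v b))"
proof
  fix d
  define b' where "b' = (SOME b. b \<in> charts_at A p)"
  have b': "b' \<in> charts_at A p" unfolding b'_def by (rule some_chart)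
  show "diff_map A F p v d = coord_vec A c (F p) (D (v b)) d"
  proof (cases "d \<in> charts_at A (F p)")
    case d: True
    have \<phi>p: "\<phi> (snd b p) = snd c (F p)"
      using F(1)[OF V(2)] chart_chart_inv[OF F(2)[OF V(2)]] charts_at_inv[OF b] by simp
    have "((snd d \<circ> chart_inv c) \<circ> \<phi> has_derivative transition c d (F p) \<circ> D) (at (snd b p))"
      by (rule diff_chain_at[OF \<phi>]) (simp add: \<phi>p has_derivative_transition c d)
    then have "((snd d \<circ> F) \<circ> chart_inv b has_derivative transition c d (F p) \<circ> D) (at (snd b p))"
      by (rule has_derivative_transform_within_open[OF _ V]) (simp add: F)
    from frechet_derivative_at[OF has_derivative_change_chart[OF b b' this]]
    have "frechet_derivative ((snd d \<circ> F) \<circ> chart_inv b') (at (snd b' p)) (v b')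
        = transition c d (F p) (D (transition b' b p (v b')))" by (metis o_apply)
    then show ?thesis
      using tangent_transition[OF v b' b] coord_vec_apply[OF c d] d
      by (simp add: diff_map_def Let_def b'_def)
  next
    case False
    then show ?thesis by (simp add: diff_map_def coord_vec_def)
  qed
qed

subsection \<open>Velocities of curves\<close>

lemma has_velocity_cong:
  assumes "\<forall>\<^sub>F s in nhds t. \<gamma> s = \<delta> s"
  shows "has_velocity A \<gamma> v t \<longleftrightarrow> has_velocity A \<delta> v t"
proof -
  have t: "\<gamma> t = \<delta> t" using assms by (rule eventually_nhds_x_imp_x)
  have "isCont \<gamma> t \<longleftrightarrow> isCont \<delta> t" using assms by (rule isCont_cong)
  moreover have "((snd c \<circ> \<gamma>) has_vector_derivative w) (at t) \<longleftrightarrow>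
      ((snd c \<circ> \<delta>) has_vector_derivative w) (at t)" for c :: "('a, 'e) chart" and w
    using assms t by (intro has_vector_derivative_cong_ev) (auto elim: eventually_mono)
  ultimately show ?thesis by (simp add: has_velocity_def t)
qed

lemma has_velocity_unique:
  assumes "has_velocity A \<gamma> v t" "has_velocity A \<gamma> w t"
  shows "v = w"
  using assms some_chart[of "\<gamma> t"] unfolding has_velocity_def
  by (intro tangent_eqI[OF _ _ some_chart, of _ "\<gamma> t"]) (blast intro: vector_derivative_unique_at)+

lemma has_velocity_chart_inv:
  assumes c: "c \<in> A" and y: "(y has_vector_derivative w) (at t)" "y t \<in> chart_range c"
  shows "has_velocity A (\<lambda>s. chart_inv c (y s)) (coord_vec A c (chart_inv c (y t)) w) t"
  unfolding has_velocity_def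
proof (intro conjI ballI)
  have ca: "c \<in> charts_at A (chart_inv c (y t))" by (rule chart_inv_at[OF c y(2)])
  have "isCont y t" using y(1) by (rule has_vector_derivative_continuous)
  then show "isCont (\<lambda>s. chart_inv c (y s)) t"
    by (rule continuous_at_compose[unfolded o_def]) (rule isCont_chart_inv[OF c y(2)])
  show "coord_vec A c (chart_inv c (y t)) w \<in> tangent_space A (chart_inv c (y t))"
    by (rule coord_vec_tangent[OF ca])
  fix d assume d: "d \<in> charts_at A (chart_inv c (y t))"
  have "((snd d \<circ> chart_inv c) \<circ> y has_derivative
      transition c d (chart_inv c (y t)) \<circ> (\<lambda>h. h *\<^sub>R w)) (at t)"
    by (rule diff_chain_at[OF y(1)[unfolded has_vector_derivative_def]])
      (use has_derivative_transition[OF ca d] y(2) in \<open>simp add: chart_chart_inv\<close>)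
  then show "((snd d \<circ> (\<lambda>s. chart_inv c (y s))) has_vector_derivative
      coord_vec A c (chart_inv c (y t)) w d) (at t)"
    using bounded_linear_transition[OF ca d]
    by (simp add: has_vector_derivative_def o_def coord_vec_apply[OF ca d] linear_scale bounded_linear.linear)
qed

end

context smooth_manifold
begin

subsection \<open>Integral curves and the flow\<close>

lemma C1_field_chart:
  assumes "vector_field A X" "c \<in> A"
  shows "C1_field (\<lambda>x. X (chart_inv c x) c) (chart_range c)"
  using assms open_chart_range by (simp add: C1_field_def vector_field_def smooth_on_def del: Ck_on.simps)

lemma integral_curve_chart:
  assumes "integral_curve A X J \<gamma>" "t \<in> J" "c \<in> A" "\<gamma> t \<in> fst c"
  shows "((\<lambda>s. snd c (\<gamma> s)) has_vector_derivative X (chart_inv c (snd c (\<gamma> t))) c) (at t)"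
proof -
  have "c \<in> charts_at A (\<gamma> t)" using assms by (simp add: charts_at_def)
  then have "((snd c \<circ> \<gamma>) has_vector_derivative X (\<gamma> t) c) (at t)"
    using assms(1,2) unfolding integral_curve_def has_velocity_def by blast
  then show ?thesis using chart_inv_chart[OF assms(3,4)] by (simp add: o_def)
qed

lemma integral_curves_agree_locally:
  assumes X: "vector_field A X" and \<gamma>: "integral_curve A X J \<gamma>" and \<delta>: "integral_curve A X J \<delta>"
    and s: "s \<in> J" "\<gamma> s = \<delta> s"
  shows "\<forall>\<^sub>F t in nhds s. \<gamma> t = \<delta> t"
proof -
  define c where "c = (SOME c. c \<in> charts_at A (\<gamma> s))"
  have c: "c \<in> A" "\<gamma> s \<in> fst c" using some_chart charts_atD unfolding c_def by metis+
  interpret C1_field "\<lambda>x. X (chart_inv c x) c" "chart_range c" by (rule C1_field_chart[OF X c(1)])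
  have J: "open J" using \<gamma> by (simp add: integral_curve_def)
  have cont: "continuous_on J \<gamma>" "continuous_on J \<delta>"
    using \<gamma> \<delta> by (auto simp: integral_curve_def has_velocity_def intro: continuous_at_imp_continuous_on)
  \<comment> \<open>Times at which both curves lie in the domain of \<open>c\<close>, where the
    Euclidean uniqueness result applies to their coordinates.\<close>
  define J' where "J' = (J \<inter> \<gamma> -` fst c) \<inter> (J \<inter> \<delta> -` fst c)"
  have "open J'"
    unfolding J'_def by (intro open_Int continuous_open_preimage cont J open_chart_domain c(1))
  have "\<forall>\<^sub>F t in nhds s. snd c (\<gamma> t) = snd c (\<delta> t)"
  proof (rule local_uniqueness[OF \<open>open J'\<close>])
    show "((\<lambda>t. snd c (\<gamma> t)) has_vector_derivative X (chart_inv c (snd c (\<gamma> t))) c) (at t)"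
      "((\<lambda>t. snd c (\<delta> t)) has_vector_derivative X (chart_inv c (snd c (\<delta> t))) c) (at t)"
      if "t \<in> J'" for t
      using integral_curve_chart[OF \<gamma> _ c(1)] integral_curve_chart[OF \<delta> _ c(1)] that
      by (auto simp: J'_def)
  qed (use s c in \<open>auto simp: J'_def\<close>)
  moreover have "\<forall>\<^sub>F t in nhds s. t \<in> J'"
    using \<open>open J'\<close> s c by (intro eventually_nhds_in_open) (auto simp: J'_def)
  ultimately show ?thesis
  proof eventually_elim
    case (elim t)
    have "chart_inv c (snd c (\<gamma> t)) = \<gamma> t" "chart_inv c (snd c (\<delta> t)) = \<delta> t"
      using elim(2) by (auto simp: J'_def intro!: chart_inv_chart c)
    then show ?case using elim(1) by metis
  qed
qed

lemma integral_curve_restrict: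
  "integral_curve A X J \<gamma> \<Longrightarrow> open J' \<Longrightarrow> is_interval J' \<Longrightarrow> J' \<subseteq> J \<Longrightarrow> integral_curve A X J' \<gamma>"
  by (auto simp: integral_curve_def)

text \<open>The set \<open>E\<close> of agreement is open by local uniqueness, and its complement in
  the common interval is open because the space is Hausdorff. Connectedness finishes the
  argument.\<close>

lemma integral_curve_unique:
  assumes X: "vector_field A X" and \<gamma>: "integral_curve A X J \<gamma>" and \<delta>: "integral_curve A X J' \<delta>"
    and "0 \<in> J" "0 \<in> J'" "\<gamma> 0 = \<delta> 0" and t: "t \<in> J" "t \<in> J'"
  shows "\<gamma> t = \<delta> t"
proof -
  define S where "S = J \<inter> J'"
  have S: "open S" "is_interval S"
    using \<gamma> \<delta> by (auto simp: integral_curve_def S_def is_interval_Int)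
  have \<gamma>S: "integral_curve A X S \<gamma>" and \<delta>S: "integral_curve A X S \<delta>"
    using integral_curve_restrict[OF \<gamma> S] integral_curve_restrict[OF \<delta> S] by (simp_all add: S_def)
  define E where "E = {s \<in> S. \<gamma> s = \<delta> s}"
  have "open E"
  proof (subst open_subopen, intro ballI)
    fix s assume s: "s \<in> E"
    have "\<forall>\<^sub>F t in nhds s. t \<in> S \<and> \<gamma> t = \<delta> t"
      using integral_curves_agree_locally[OF X \<gamma>S \<delta>S, of s] eventually_nhds_in_open[OF S(1), of s] s
      by (auto simp: E_def eventually_conj_iff)
    then show "\<exists>T. open T \<and> s \<in> T \<and> T \<subseteq> E" unfolding eventually_nhds E_def by blast
  qed
  moreover have "open (S - E)"
  proof (subst open_subopen, intro ballI)
    fix s assume s: "s \<in> S - E"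
    obtain U V where UV: "open U" "open V" "\<gamma> s \<in> U" "\<delta> s \<in> V" "U \<inter> V = {}"
      using hausdorff[of "\<gamma> s" "\<delta> s"] s by (auto simp: E_def)
    have cont: "continuous_on S \<gamma>" "continuous_on S \<delta>"
      using \<gamma>S \<delta>S by (auto simp: integral_curve_def has_velocity_def intro: continuous_at_imp_continuous_on)
    have "open ((S \<inter> \<gamma> -` U) \<inter> (S \<inter> \<delta> -` V))"
      by (intro open_Int continuous_open_preimage cont S UV)
    moreover have "(S \<inter> \<gamma> -` U) \<inter> (S \<inter> \<delta> -` V) \<subseteq> S - E" using UV(5) by (auto simp: E_def)
    ultimately show "\<exists>T. open T \<and> s \<in> T \<and> T \<subseteq> S - E" using s UV by blast
  qed
  ultimately have "E = {} \<or> S - E = {}"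
    using connectedD[OF is_interval_connected[OF S(2)], of E "S - E"] by (auto simp: E_def)
  moreover have "0 \<in> E" using assms by (simp add: E_def S_def)
  ultimately show ?thesis using t by (auto simp: E_def S_def)
qed

lemma flow_eqI:
  assumes "vector_field A X" "flows_to A X t m y"
  shows "flow A X t m = y"
  unfolding flow_def
proof (rule the_equality, rule assms(2))
  show "z = y" if z: "flows_to A X t m z" for z
    using z assms(2) integral_curve_unique[OF assms(1)] unfolding flows_to_def by (metis (no_types, lifting))
qed

lemma flow_in_chart:
  assumes X: "vector_field A X" and c: "c \<in> charts_at A m"
  obtains T r \<phi> M where "0 < T" "0 < r" "ball (snd c m) r \<subseteq> chart_range c"
    and "\<And>x. x \<in> ball (snd c m) r \<Longrightarrow> \<phi> 0 x = x"
    and "\<And>x t. x \<in> ball (snd c m) r \<Longrightarrow> t \<in> {-T<..<T} \<Longrightarrow> \<phi> t x \<in> chart_range c"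
    and "\<And>x t. x \<in> ball (snd c m) r \<Longrightarrow> t \<in> {-T<..<T} \<Longrightarrow>
      ((\<lambda>s. \<phi> s x) has_vector_derivative X (chart_inv c (\<phi> t x)) c) (at t)"
    and "\<And>t. t \<in> {-T<..<T} \<Longrightarrow> (\<phi> t has_derivative M t) (at (snd c m))"
    and "\<And>w. M 0 w = w"
    and "\<And>w. ((\<lambda>t. M t w) has_vector_derivative
      frechet_derivative (\<lambda>x. X (chart_inv c x) c) (at (snd c m)) w) (at 0)"
    and "\<And>x t. x \<in> ball (snd c m) r \<Longrightarrow> t \<in> {-T<..<T} \<Longrightarrow> flows_to A X t (chart_inv c x) (chart_inv c (\<phi> t x))"
proof -
  have cA: "c \<in> A" using c by (rule charts_atD)
  interpret C1_field "\<lambda>x. X (chart_inv c x) c" "chart_range c" by (rule C1_field_chart[OF X cA])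
  obtain T r \<phi> M where T: "0 < T" and r: "0 < r"
    and \<phi>0: "\<And>x. x \<in> ball (snd c m) r \<Longrightarrow> \<phi> 0 x = x"
    and \<phi>: "\<And>x t. x \<in> ball (snd c m) r \<Longrightarrow> t \<in> {-T<..<T} \<Longrightarrow> \<phi> t x \<in> chart_range c"
     "\<And>x t. x \<in> ball (snd c m) r \<Longrightarrow> t \<in> {-T<..<T} \<Longrightarrow>
      ((\<lambda>s. \<phi> s x) has_vector_derivative X (chart_inv c (\<phi> t x)) c) (at t)"
    and M: "\<And>t. t \<in> {-T<..<T} \<Longrightarrow> (\<phi> t has_derivative M t) (at (snd c m))" "\<And>w. M 0 w = w"
     "\<And>w. ((\<lambda>t. M t w) has_vector_derivative
      frechet_derivative (\<lambda>x. X (chart_inv c x) c) (at (snd c m)) w) (at 0)"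
    by (rule local_flow[OF charts_at_range[OF c]]) blast
  show thesis
  proof (rule that[OF T r _ \<phi>0 \<phi> M])
    show "ball (snd c m) r \<subseteq> chart_range c"
    proof
      fix x assume "x \<in> ball (snd c m) r"
      then show "x \<in> chart_range c" using \<phi>(1)[of x 0] \<phi>0[of x] T by simp
    qed
    fix x t assume x: "x \<in> ball (snd c m) r" and t: "t \<in> {-T<..<T}"
    have "has_velocity A (\<lambda>s. chart_inv c (\<phi> s x)) (X (chart_inv c (\<phi> s x))) s" if s: "s \<in> {-T<..<T}" for s
    proof -
      have "X (chart_inv c (\<phi> s x)) \<in> tangent_space A (chart_inv c (\<phi> s x))"
        using X by (simp add: vector_field_def)
      from coord_vec_tangent_eq[OF this chart_inv_at[OF cA \<phi>(1)[OF x s]]]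
      show ?thesis using has_velocity_chart_inv[OF cA \<phi>(2)[OF x s] \<phi>(1)[OF x s]] by simp
    qed
    then have "integral_curve A X {-T<..<T} (\<lambda>s. chart_inv c (\<phi> s x))"
      by (simp add: integral_curve_def is_interval_oo)
    then show "flows_to A X t (chart_inv c x) (chart_inv c (\<phi> t x))"
      unfolding flows_to_def using \<phi>0[OF x] T t
      by (intro exI[of _ "{-T<..<T}"] exI[of _ "\<lambda>s. chart_inv c (\<phi> s x)"]) simp
  qed
qed

text \<open>Near time 0 the curve \<open>flow A X t m\<close> is the chart solution, with velocity
  \<open>X m\<close>, and velocities are unique. This inclusion puts every covector that kills
  \<open>X m\<close> into the orbit annihilator.\<close>

lemma orbit_tangent_space_subset:
  assumes X: "vector_field A X"
  shows "orbit_tangent_space A X m \<subseteq> span {X m}"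
proof -
  define c where "c = (SOME c. c \<in> charts_at A m)"
  have c: "c \<in> charts_at A m" unfolding c_def by (rule some_chart)
  have cA: "c \<in> A" using c by (rule charts_atD)
  obtain T r \<phi> M where T: "0 < T" and r: "0 < r"
    and \<phi>0': "\<And>x. x \<in> ball (snd c m) r \<Longrightarrow> \<phi> 0 x = x"
    and \<phi>': "\<And>x t. x \<in> ball (snd c m) r \<Longrightarrow> t \<in> {-T<..<T} \<Longrightarrow>
      ((\<lambda>s. \<phi> s x) has_vector_derivative X (chart_inv c (\<phi> t x)) c) (at t)"
    and M: "\<And>t. t \<in> {-T<..<T} \<Longrightarrow> (\<phi> t has_derivative M t) (at (snd c m))"
    and fl': "\<And>x t. x \<in> ball (snd c m) r \<Longrightarrow> t \<in> {-T<..<T} \<Longrightarrow> flows_to A X t (chart_inv c x) (chart_inv c (\<phi> t x))"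
    by (rule flow_in_chart[OF X c]) blast
  have \<phi>0: "\<phi> 0 (snd c m) = snd c m" using \<phi>0' r by simp
  have \<phi>: "((\<lambda>s. \<phi> s (snd c m)) has_vector_derivative X (chart_inv c (\<phi> 0 (snd c m))) c) (at 0)"
    using \<phi>'[of "snd c m" 0] r T by simp
  have fl: "flows_to A X t (chart_inv c (snd c m)) (chart_inv c (\<phi> t (snd c m)))" if "t \<in> {-T<..<T}" for t
    using fl'[OF _ that] r by simp
  have m: "chart_inv c (snd c m) = m" by (rule charts_at_inv[OF c])
  have "has_velocity A (\<lambda>s. chart_inv c (\<phi> s (snd c m))) (coord_vec A c m (X m c)) 0"
    using has_velocity_chart_inv[OF cA \<phi>] charts_at_range[OF c] by (simp add: \<phi>0 m)
  moreover have "coord_vec A c m (X m c) = X m"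
    using X by (intro coord_vec_tangent_eq c) (simp add: vector_field_def)
  moreover have "\<forall>\<^sub>F t in nhds 0. flow A X t m = chart_inv c (\<phi> t (snd c m))"
  proof -
    have "\<forall>\<^sub>F t in nhds 0. t \<in> {-T<..<T}" using T by (intro eventually_nhds_in_open) auto
    then show ?thesis by eventually_elim (rule flow_eqI[OF X], use fl m in simp)
  qed
  ultimately have "has_velocity A (\<lambda>t. flow A X t m) (X m) 0"
    using has_velocity_cong[of "\<lambda>t. flow A X t m" "\<lambda>s. chart_inv c (\<phi> s (snd c m))"] by simp
  then have "{v. has_velocity A (\<lambda>t. flow A X t m) v 0} \<subseteq> {X m}"
    using has_velocity_unique by blast
  then show ?thesis unfolding orbit_tangent_space_def by (rule span_mono)
qed

lemma orbit_annihilatorI: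
  assumes X: "vector_field A X" and \<beta>: "\<beta> \<in> cotangent_space A m" "\<beta> (X m) = 0"
  shows "\<beta> \<in> orbit_annihilator A X m"
proof -
  have Xm: "X m \<in> tangent_space A m" using X by (simp add: vector_field_def)
  have "\<beta> v = 0" if v: "v \<in> orbit_tangent_space A X m" for v
  proof -
    obtain k where "v = k *\<^sub>R X m" using v orbit_tangent_space_subset[OF X, of m]
      unfolding span_singleton by blast
    then show ?thesis using cotangent_scaleR[OF \<beta>(1) Xm] \<beta>(2) by simp
  qed
  then show ?thesis using \<beta> by (simp add: orbit_annihilator_def)
qed

end

section \<open>Riemannian metrics and gradients\<close>

locale riemannian_manifold = smooth_manifold A
  for A :: "('a::{t2_space, second_countable_topology}, 'e::euclidean_space) chart set" +
  fixes g :: "('a, 'e) metric_field"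
  assumes metric: "riemannian_metric A g"
begin

lemma metric_sym: "v \<in> tangent_space A p \<Longrightarrow> w \<in> tangent_space A p \<Longrightarrow> g p v w = g p w v"
  and metric_linear: "v \<in> tangent_space A p \<Longrightarrow> linear_functional_on (tangent_space A p) (g p v)"
  and metric_pos: "v \<in> tangent_space A p \<Longrightarrow> v \<noteq> 0 \<Longrightarrow> g p v v > 0"
  using metric unfolding riemannian_metric_def by blast+

definition gram where
  "gram c p i j = g p (coord_vec A c p i) (coord_vec A c p j)"

lemma metric_gram:
  assumes c: "c \<in> charts_at A p" and v: "v \<in> tangent_space A p" and w: "w \<in> tangent_space A p"
  shows "g p v w = (\<Sum>i\<in>Basis. \<Sum>j\<in>Basis. gram c p i j * (v c \<bullet> i) * (w c \<bullet> j))"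
proof -
  note T = coord_vec_tangent[OF c]
  have "g p v w = (\<Sum>j\<in>Basis. (w c \<bullet> j) * g p v (coord_vec A c p j))"
    by (rule linear_functional_coords[OF metric_linear[OF v] c w])
  also have "\<dots> = (\<Sum>j\<in>Basis. (w c \<bullet> j) * (\<Sum>i\<in>Basis. (v c \<bullet> i) * g p (coord_vec A c p j) (coord_vec A c p i)))"
    using linear_functional_coords[OF metric_linear[OF T] c v] metric_sym[OF v T] by simp
  also have "\<dots> = (\<Sum>j\<in>Basis. \<Sum>i\<in>Basis. gram c p i j * (v c \<bullet> i) * (w c \<bullet> j))"
    unfolding sum_distrib_left using metric_sym[OF T T] by (simp add: gram_def mult_ac)
  finally show ?thesis by (subst sum.swap)
qed

lemma pos_def_gram:
  assumes c: "c \<in> charts_at A p"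
  shows "pos_def_on Basis (gram c p)"
  unfolding pos_def_on_def
proof (intro conjI ballI allI impI)
  show "gram c p i j = gram c p j i" for i j
    unfolding gram_def by (intro metric_sym coord_vec_tangent c)
  fix z :: "'e \<Rightarrow> real" assume "\<exists>i\<in>Basis. z i \<noteq> 0"
  define u where "u = (\<Sum>i\<in>Basis. z i *\<^sub>R i)"
  have u: "u \<bullet> i = z i" if "i \<in> Basis" for i using that by (simp add: u_def)
  have uT: "coord_vec A c p u \<in> tangent_space A p" by (rule coord_vec_tangent[OF c])
  have "coord_vec A c p u \<noteq> 0"
  proof
    assume "coord_vec A c p u = 0"
    then have "u = 0" using coord_vec_self[OF c, of u] by simp
    then show False using \<open>\<exists>i\<in>Basis. z i \<noteq> 0\<close> u by auto
  qed
  then have "0 < g p (coord_vec A c p u) (coord_vec A c p u)" by (rule metric_pos[OF uT])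
  also have "\<dots> = (\<Sum>i\<in>Basis. \<Sum>j\<in>Basis. gram c p i j * z i * z j)"
    by (simp add: metric_gram[OF c uT uT] coord_vec_self[OF c] u)
  finally show "0 < (\<Sum>i\<in>Basis. \<Sum>j\<in>Basis. gram c p i j * z i * z j)" .
qed

text \<open>In a chart, lowering an index is the linear map \<open>f\<close> given by the Gram
  matrix. Positivity of the metric makes it injective, hence surjective in finite dimension;
  positivity also gives uniqueness.\<close>

lemma metric_dual_vec:
  assumes \<alpha>: "\<alpha> \<in> cotangent_space A p"
  shows metric_dual_vec_tangent: "metric_dual_vec A g p \<alpha> \<in> tangent_space A p"
    and metric_dual_vec_eq: "w \<in> tangent_space A p \<Longrightarrow> g p (metric_dual_vec A g p \<alpha>) w = \<alpha> w"
proof -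
  define c where "c = (SOME c. c \<in> charts_at A p)"
  have c: "c \<in> charts_at A p" unfolding c_def by (rule some_chart)
  note T = coord_vec_tangent[OF c]
  define f where "f u = (\<Sum>j\<in>Basis. g p (coord_vec A c p j) (coord_vec A c p u) *\<^sub>R j)" for u
  have "linear f"
    unfolding f_def
    using metric_linear[OF T] T
    by (intro linearI) (simp_all add: coord_vec_add[OF c] coord_vec_scaleR[OF c] linear_functional_on_def
        scaleR_add_left sum.distrib scaleR_sum_right)
  moreover have "u = 0" if "f u = 0" for u
  proof (rule ccontr)
    assume "u \<noteq> 0"
    have "g p (coord_vec A c p u) (coord_vec A c p j) = 0" if "j \<in> Basis" for j
      using arg_cong[OF \<open>f u = 0\<close>, of "\<lambda>x. x \<bullet> j"] that metric_sym[OF T T, of u j] by (simp add: f_def)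
    then have "g p (coord_vec A c p u) (coord_vec A c p u) = 0"
      by (simp add: linear_functional_coords[OF metric_linear[OF T] c T, of u u])
    moreover have "coord_vec A c p u \<noteq> 0"
      using coord_vec_self[OF c, of u] \<open>u \<noteq> 0\<close> by (metis zero_fun_apply)
    ultimately show False using metric_pos[OF T, of u] by simp
  qed
  ultimately have "inj f" by (simp add: linear_injective_0)
  with \<open>linear f\<close> have "surj f" by (rule linear_inj_imp_surj)
  then obtain u where u: "f u = (\<Sum>j\<in>Basis. \<alpha> (coord_vec A c p j) *\<^sub>R j)" by (metis surjD)
  define v where "v = coord_vec A c p u"
  have vT: "v \<in> tangent_space A p" unfolding v_def by (rule T)
  have vj: "g p v (coord_vec A c p j) = \<alpha> (coord_vec A c p j)" if "j \<in> Basis" for j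
    using arg_cong[OF u, of "\<lambda>x. x \<bullet> j"] that metric_sym[OF T vT, of j] by (simp add: f_def v_def)
  have v: "g p v w = \<alpha> w" if w: "w \<in> tangent_space A p" for w
    unfolding linear_functional_coords[OF metric_linear[OF vT] c w]
      linear_functional_coords[OF cotangent_linear[OF \<alpha>] c w] by (simp add: vj)
  have "metric_dual_vec A g p \<alpha> = v"
    unfolding metric_dual_vec_def
  proof (rule the_equality)
    fix z assume z: "z \<in> tangent_space A p \<and> (\<forall>w\<in>tangent_space A p. g p z w = \<alpha> w)"
    show "z = v"
    proof (rule ccontr)
      assume "z \<noteq> v"
      have zv: "z - v \<in> tangent_space A p" using z vT subspace_diff[OF subspace_tangent] by blast
      have "g p (z - v) (v + (z - v)) = g p (z - v) v + g p (z - v) (z - v)"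
        using metric_linear[OF zv] vT zv unfolding linear_functional_on_def by blast
      moreover have "v + (z - v) = z" by simp
      ultimately have "g p z (z - v) = g p v (z - v) + g p (z - v) (z - v)"
        using metric_sym[OF zv vT] metric_sym[OF zv, of z] z by simp
      then have "g p (z - v) (z - v) = 0" using z v[OF zv] zv by simp
      then show False using metric_pos[OF zv] \<open>z \<noteq> v\<close> by simp
    qed
  qed (use vT v in simp)
  then show "metric_dual_vec A g p \<alpha> \<in> tangent_space A p"
    "w \<in> tangent_space A p \<Longrightarrow> g p (metric_dual_vec A g p \<alpha>) w = \<alpha> w"
    using vT v by auto
qed

lemma dual_metric_eq:
  assumes "\<alpha> \<in> cotangent_space A p" "\<beta> \<in> cotangent_space A p"
  shows "dual_metric A g p \<alpha> \<beta> = \<beta> (metric_dual_vec A g p \<alpha>)"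
  unfolding dual_metric_def
  using metric_dual_vec_tangent metric_dual_vec_eq metric_sym assms by metis

text \<open>By \<open>dual_metric_eq\<close>, pairing dh with a covector under the dual metric
  evaluates that covector at the metric dual of dh, so this vector meets the characterization of
  \<open>sharp\<close>.\<close>

lemma gradient_eq:
  assumes "smooth_fun A h"
  shows "gradient A g h p = metric_dual_vec A g p (diff_fun A h p)"
  unfolding gradient_def
  using diff_fun_cotangent[OF assms] by (intro sharp_eqI metric_dual_vec_tangent) (simp_all add: dual_metric_eq)

lemma gradient_tangent: "smooth_fun A h \<Longrightarrow> gradient A g h p \<in> tangent_space A p"
  by (simp add: gradient_eq metric_dual_vec_tangent diff_fun_cotangent)

lemma metric_gradient:
  "smooth_fun A h \<Longrightarrow> w \<in> tangent_space A p \<Longrightarrow> g p (gradient A g h p) w = diff_fun A h p w"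
  by (simp add: gradient_eq metric_dual_vec_eq diff_fun_cotangent)

lemma dual_metric_diff_fun:
  "smooth_fun A h \<Longrightarrow> \<beta> \<in> cotangent_space A p \<Longrightarrow>
    dual_metric A g p (diff_fun A h p) \<beta> = \<beta> (gradient A g h p)"
  by (simp add: gradient_eq dual_metric_eq diff_fun_cotangent)

text \<open>The components of the gradient solve the linear system of the Gram matrix with the
  partial derivatives of \<open>h\<close> on the right. Elimination then gives smoothness without a
  formula for the inverse matrix.\<close>

lemma smooth_on_gradient:
  assumes h: "smooth_fun A h" and c: "c \<in> A"
  shows "smooth_on (\<lambda>x. gradient A g h (chart_inv c x) c) (chart_range c)"
proof -
  let ?W = "\<lambda>x. gradient A g h (chart_inv c x) c"
  note R = open_chart_range[OF c]
  have "smooth_on (\<lambda>x. ?W x \<bullet> i) (chart_range c)" if i: "i \<in> Basis" for i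
  proof (rule smooth_on_pos_def_solution[where I = Basis and G = "\<lambda>x. gram c (chart_inv c x)"
        and r = "\<lambda>x j. frechet_derivative (h \<circ> chart_inv c) (at x) j" and w = "\<lambda>x i. ?W x \<bullet> i"])
    show "smooth_on (\<lambda>x. gram c (chart_inv c x) i j) (chart_range c)" if "i \<in> Basis" "j \<in> Basis" for i j
      using metric c that unfolding riemannian_metric_def gram_def by blast
    show "smooth_on (\<lambda>x. frechet_derivative (h \<circ> chart_inv c) (at x) j) (chart_range c)" for j
      by (intro smooth_on_frechet_derivative smooth_fun_chart h c)
    fix x j assume x: "x \<in> chart_range c" and j: "(j::'e) \<in> Basis"
    let ?p = "chart_inv c x"
    have cp: "c \<in> charts_at A ?p" by (rule chart_inv_at[OF c x])
    note T = coord_vec_tangent[OF cp, of j]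
    have "frechet_derivative (h \<circ> chart_inv c) (at x) j = diff_fun A h ?p (coord_vec A c ?p j)"
      using diff_fun_coord[OF h T cp] by (simp add: coord_vec_self[OF cp] chart_chart_inv[OF x])
    also have "\<dots> = g ?p (coord_vec A c ?p j) (gradient A g h ?p)"
      using metric_gradient[OF h T] metric_sym[OF T gradient_tangent[OF h]] by simp
    also have "\<dots> = (\<Sum>i\<in>Basis. gram c ?p j i * (?W x \<bullet> i))"
      unfolding gram_def
      using linear_functional_coords[OF metric_linear[OF T] cp gradient_tangent[OF h]]
      by (simp add: mult.commute)
    finally show "(\<Sum>i\<in>Basis. gram c ?p j i * (?W x \<bullet> i)) = frechet_derivative (h \<circ> chart_inv c) (at x) j" ..
  qed (use R i pos_def_gram chart_inv_at[OF c] in auto)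
  then have "smooth_on (\<lambda>x. \<Sum>i\<in>Basis. (?W x \<bullet> i) *\<^sub>R i) (chart_range c)"
    by (intro smooth_on_sum smooth_on_scaleR smooth_on_const R)
  then show ?thesis by (simp add: euclidean_representation)
qed

end

section \<open>The Poisson structure\<close>

lemma smooth_on_apply:
  fixes D :: "'e::euclidean_space \<Rightarrow> 'e \<Rightarrow> real"
  assumes "open S" "\<And>v. smooth_on (\<lambda>x. D x v) S" "smooth_on w S" "\<And>x. x \<in> S \<Longrightarrow> linear (D x)"
  shows "smooth_on (\<lambda>x. D x (w x)) S"
proof -
  have "smooth_on (\<lambda>x. \<Sum>i\<in>Basis. (w x \<bullet> i) * D x i) S"
    using assms by (intro smooth_on_sum smooth_on_mult smooth_on_inner smooth_on_const)
  moreover have "D x (w x) = (\<Sum>i\<in>Basis. (w x \<bullet> i) * D x i)" if "x \<in> S" for x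
    using arg_cong[OF euclidean_representation[of "w x"], of "D x"] assms(4)[OF that]
    by (simp add: linear_sum linear_scale)
  ultimately show ?thesis using smooth_on_cong[OF assms(1)] by (metis (no_types, lifting))
qed

text \<open>Here \<open>v\<close>, \<open>y\<close> are the components of V and X at a point, and
  \<open>b\<close>, \<open>p\<close>, \<open>q\<close> those of DX(V), DX(X), DV(V); the components
  of DV(X) are replaced by b + \<mu> y, because [X, V] = \<mu> X. Then \<open>F i j k\<close> is V^i
  times the X-derivative of \<pi>^jk minus X^i times its V-derivative. The cyclic sum occurs twice
  because both arguments of the bracket are \<pi>.\<close>

lemma schouten_polynomial:
  fixes v y b p q :: "'n \<Rightarrow> real" and \<mu> :: real
  defines "F \<equiv> \<lambda>i j k. v i * ((b j + \<mu> * y j) * y k + v j * p k - (p j * v k + y j * (b k + \<mu> * y k)))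
    - y i * (q j * y k + v j * b k - (b j * v k + y j * q k))"
  shows "F i j k + F j k i + F k i j + F i j k + F j k i + F k i j = 0"
  unfolding F_def by algebra

text \<open>Contraction over the index l in the Schouten bracket: the coefficients of V \<and> X
  turn partial derivatives into derivatives along X and V.\<close>

lemma sum_Basis_linear:
  fixes D :: "'e::euclidean_space \<Rightarrow> real"
  assumes "linear D"
  shows "(\<Sum>l\<in>Basis. (a * (y \<bullet> l) - b * (v \<bullet> l)) * D l) = a * D y - b * D v"
proof -
  have D: "D w = (\<Sum>l\<in>Basis. (w \<bullet> l) * D l)" for w
    using arg_cong[OF euclidean_representation[of w], of D] assms by (simp add: linear_sum linear_scale)
  show ?thesis
    unfolding D[of y] D[of v] by (simp add: sum_distrib_left sum_subtractf left_diff_distrib mult.assoc)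
qed

locale transversally_invariant_field = riemannian_manifold A g
  for A :: "('a::{t2_space, second_countable_topology}, 'e::euclidean_space) chart set"
    and g :: "('a, 'e) metric_field" +
  fixes X :: "'a \<Rightarrow> ('a, 'e) tvec" and h :: "'a \<Rightarrow> real"
  assumes X: "vector_field A X"
    and fi: "first_integral A X h"
    and invariant: "transversally_invariant A X g"
begin

lemma h: "smooth_fun A h"
  using fi by (simp add: first_integral_def)

lemma X_tangent: "X p \<in> tangent_space A p"
  using X by (simp add: vector_field_def)

lemma diff_fun_X: "diff_fun A h p (X p) = 0"
  using fi by (simp add: first_integral_def)

abbreviation "grad \<equiv> gradient A g h"

definition "gnorm2 p = g p (grad p) (grad p)"

lemmas grad_tangent = gradient_tangent[OF h]

lemma diff_fun_grad: "diff_fun A h p (grad p) = gnorm2 p"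
  using metric_gradient[OF h grad_tangent] by (simp add: gnorm2_def)

text \<open>The chain rule applied to the identity h(F(x)) = h(x), which is available near
  \<open>m\<close> in the chart.\<close>

lemma pullback_diff_fun:
  assumes c: "c \<in> charts_at A m" "c \<in> charts_at A (F m)"
    and V: "open V" "snd c m \<in> V" "V \<subseteq> chart_range c"
    and F: "\<And>x. x \<in> V \<Longrightarrow> F (chart_inv c x) = chart_inv c (\<phi> x)" "\<And>x. x \<in> V \<Longrightarrow> \<phi> x \<in> chart_range c"
    and \<phi>: "(\<phi> has_derivative D) (at (snd c m))"
    and hF: "\<And>x. x \<in> V \<Longrightarrow> h (chart_inv c (\<phi> x)) = h (chart_inv c x)"
  shows "pullback A F m (diff_fun A h (F m)) = diff_fun A h m"
proof
  fix v
  show "pullback A F m (diff_fun A h (F m)) v = diff_fun A h m v"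
  proof (cases "v \<in> tangent_space A m")
    case v: True
    let ?h = "h \<circ> chart_inv c"
    have \<phi>m: "\<phi> (snd c m) = snd c (F m)"
      using F(1)[OF V(2)] chart_chart_inv[OF F(2)[OF V(2)]] charts_at_inv[OF c(1)] by simp
    have Dh: "(?h has_derivative frechet_derivative ?h (at x)) (at x)" if "x \<in> chart_range c" for x
      using that by (intro smooth_on_has_derivative[OF smooth_fun_chart[OF h]] charts_atD(1)[OF c(1)])
    have "(?h \<circ> \<phi> has_derivative frechet_derivative ?h (at (snd c (F m))) \<circ> D) (at (snd c m))"
      by (rule diff_chain_at[OF \<phi>]) (simp add: \<phi>m Dh charts_at_range[OF c(2)])
    then have "(?h has_derivative frechet_derivative ?h (at (snd c (F m))) \<circ> D) (at (snd c m))"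
      by (rule has_derivative_transform_within_open[OF _ V(1,2)]) (simp add: hF)
    then have "frechet_derivative ?h (at (snd c m)) = frechet_derivative ?h (at (snd c (F m))) \<circ> D"
      by (rule has_derivative_unique[OF Dh[OF charts_at_range[OF c(1)]]])
    moreover have "pullback A F m (diff_fun A h (F m)) v
        = diff_fun A h (F m) (coord_vec A c (F m) (D (v c)))"
      using v diff_map_coord[OF c V(1,2) F \<phi> v] by (simp add: pullback_def)
    ultimately show ?thesis
      using diff_fun_coord[OF h coord_vec_tangent[OF c(2)] c(2)] diff_fun_coord[OF h v c(1)]
      by (simp add: coord_vec_self[OF c(2)])
  next
    case False
    then show ?thesis by (simp add: pullback_def diff_fun_def)
  qed
qed

text \<open>The transposed differential of the flow fixes \<open>dh\<close> and is isometric on the annihilators, so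
  the differential of the flow carries the gradient to the gradient modulo \<open>X\<close>.\<close>

lemma gradient_along_flow:
  assumes c: "c \<in> charts_at A m"
    and V: "open V" "snd c m \<in> V" "V \<subseteq> chart_range c"
    and fl: "\<And>x. x \<in> V \<Longrightarrow> flows_to A X t (chart_inv c x) (chart_inv c (\<phi> x))"
    and range: "\<And>x. x \<in> V \<Longrightarrow> \<phi> x \<in> chart_range c"
    and \<phi>: "(\<phi> has_derivative D) (at (snd c m))"
    and h\<phi>: "\<And>x. x \<in> V \<Longrightarrow> h (chart_inv c (\<phi> x)) = h (chart_inv c x)"
    and q: "q = chart_inv c (\<phi> (snd c m))"
  shows "gnorm2 q = gnorm2 m"
    and "\<xi> \<bullet> X q c = 0 \<Longrightarrow> \<xi> \<bullet> D (grad m c) = \<xi> \<bullet> grad q c"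
proof -
  let ?F = "flow A X t"
  have m: "chart_inv c (snd c m) = m" by (rule charts_at_inv[OF c])
  have F: "?F (chart_inv c x) = chart_inv c (\<phi> x)" if "x \<in> V" for x
    by (rule flow_eqI[OF X fl[OF that]])
  have Fm: "?F m = q" using F[OF V(2)] by (simp add: m q)
  have defd: "flow_defined A X t m" unfolding flow_defined_def using fl[OF V(2)] m by auto
  have cq: "c \<in> charts_at A q" unfolding q by (intro chart_inv_at range V charts_atD(1)[OF c])
  note cF = cq[folded Fm]
  have bij: "bij_betw (pullback A ?F m) (orbit_annihilator A X q) (orbit_annihilator A X m)"
    and iso: "\<And>\<alpha> \<beta>. \<alpha> \<in> orbit_annihilator A X q \<Longrightarrow> \<beta> \<in> orbit_annihilator A X q \<Longrightarrow>
      dual_metric A g m (pullback A ?F m \<alpha>) (pullback A ?F m \<beta>) = dual_metric A g q \<alpha> \<beta>"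
    using invariant defd unfolding transversally_invariant_def Fm[symmetric] by blast+
  have dh: "diff_fun A h q \<in> orbit_annihilator A X q"
    by (intro orbit_annihilatorI[OF X] diff_fun_cotangent h diff_fun_X)
  have pdh: "pullback A ?F m (diff_fun A h q) = diff_fun A h m"
    using pullback_diff_fun[OF c cF V F range \<phi> h\<phi>] by (simp add: Fm)
  \<comment> \<open>The isometry is applied to the pair dh, \<beta>. Since dh pulls back to dh, and
    pairing with dh is evaluation at the gradient, this relates the gradients at \<open>m\<close>
    and \<open>q\<close>. Taking \<beta> = dh gives the constancy of the norm.\<close>
  have main: "pullback A ?F m \<beta> (grad m) = \<beta> (grad q)" if \<beta>: "\<beta> \<in> orbit_annihilator A X q" for \<beta>
  proof -
    have "pullback A ?F m \<beta> \<in> orbit_annihilator A X m" using bij \<beta> by (rule bij_betw_apply)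
    then have "pullback A ?F m \<beta> \<in> cotangent_space A m" "\<beta> \<in> cotangent_space A q"
      using \<beta> by (auto simp: orbit_annihilator_def)
    then show ?thesis using iso[OF dh \<beta>] by (simp add: pdh dual_metric_diff_fun[OF h])
  qed
  show "gnorm2 q = gnorm2 m" using main[OF dh] by (simp add: pdh diff_fun_grad)
  assume \<xi>: "\<xi> \<bullet> X q c = 0"
  \<comment> \<open>Vectors \<xi> orthogonal to X in the chart provide the test covectors that
    express equality modulo X.\<close>
  have "coord_covec A c q \<xi> \<in> orbit_annihilator A X q"
    by (intro orbit_annihilatorI[OF X] coord_covec_cotangent)
      (simp add: coord_covec_apply X_tangent \<xi> inner_commute)
  from main[OF this] have "coord_covec A c q \<xi> (diff_map A ?F m (grad m)) = coord_covec A c q \<xi> (grad q)"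
    by (simp add: pullback_def grad_tangent)
  then have "coord_covec A c q \<xi> (coord_vec A c q (D (grad m c))) = coord_covec A c q \<xi> (grad q)"
    using diff_map_coord[OF c cF V(1,2) F range \<phi> grad_tangent] by (simp add: Fm)
  then show "\<xi> \<bullet> D (grad m c) = \<xi> \<bullet> grad q c"
    by (simp add: coord_covec_apply grad_tangent coord_vec_tangent[OF cq] coord_vec_self[OF cq] inner_commute)
qed

lemma first_integral_along_flow:
  assumes c: "c \<in> A" and T: "0 < T"
    and y: "\<And>t. t \<in> {-T<..<T} \<Longrightarrow> y t \<in> chart_range c"
    "\<And>t. t \<in> {-T<..<T} \<Longrightarrow> (y has_vector_derivative X (chart_inv c (y t)) c) (at t)"
    and t: "t \<in> {-T<..<T}"
  shows "h (chart_inv c (y t)) = h (chart_inv c (y 0))"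
proof -
  have "((\<lambda>s. (h \<circ> chart_inv c) (y s)) has_derivative (\<lambda>_. 0)) (at s within {-T<..<T})"
    if s: "s \<in> {-T<..<T}" for s
  proof -
    have cs: "c \<in> charts_at A (chart_inv c (y s))" by (rule chart_inv_at[OF c y(1)[OF s]])
    have Dh: "(h \<circ> chart_inv c has_derivative frechet_derivative (h \<circ> chart_inv c) (at (y s))) (at (y s))"
      by (rule smooth_on_has_derivative[OF smooth_fun_chart[OF h c] y(1)[OF s]])
    have "frechet_derivative (h \<circ> chart_inv c) (at (y s)) (X (chart_inv c (y s)) c) = 0"
      using diff_fun_coord[OF h X_tangent cs] diff_fun_X by (simp add: chart_chart_inv[OF y(1)[OF s]])
    moreover have "((h \<circ> chart_inv c) \<circ> y has_derivative
        frechet_derivative (h \<circ> chart_inv c) (at (y s)) \<circ> (\<lambda>r. r *\<^sub>R X (chart_inv c (y s)) c)) (at s)"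
      by (rule diff_chain_at[OF y(2)[OF s, unfolded has_vector_derivative_def] Dh])
    ultimately have "((h \<circ> chart_inv c) \<circ> y has_derivative (\<lambda>_. 0)) (at s)"
      using linear_scale[OF has_derivative_linear[OF Dh]] by (simp add: o_def)
    then show ?thesis by (auto simp: o_def intro: has_derivative_at_withinI)
  qed
  then have "\<exists>k. \<forall>s\<in>{-T<..<T}. (h \<circ> chart_inv c) (y s) = k"
    by (intro has_derivative_zero_constant) auto
  then show ?thesis using t T by fastforce
qed

section \<open>Coordinate representatives and the bracket of X with the normalized gradient\<close>

definition chart_field where "chart_field c x = X (chart_inv c x) c"
definition chart_grad where "chart_grad c x = grad (chart_inv c x) c"
definition chart_norm2 where "chart_norm2 c x = gnorm2 (chart_inv c x)"
text \<open>The normalization is dh(V) = 1, not unit length.\<close>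

definition chart_unit where "chart_unit c x = chart_grad c x /\<^sub>R chart_norm2 c x"

lemma smooth_on_chart_field: "c \<in> A \<Longrightarrow> smooth_on (chart_field c) (chart_range c)"
  using X by (simp add: vector_field_def chart_field_def[abs_def])

lemma smooth_on_chart_grad: "c \<in> A \<Longrightarrow> smooth_on (chart_grad c) (chart_range c)"
  unfolding chart_grad_def[abs_def] by (rule smooth_on_gradient[OF h])

lemma smooth_on_chart_norm2:
  assumes c: "c \<in> A"
  shows "smooth_on (chart_norm2 c) (chart_range c)"
proof -
  note Dh = smooth_fun_chart[OF h c]
  have eq: "chart_norm2 c x = frechet_derivative (h \<circ> chart_inv c) (at x) (chart_grad c x)"
    if x: "x \<in> chart_range c" for x
    unfolding chart_norm2_def chart_grad_def diff_fun_grad[symmetric]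
    using diff_fun_coord[OF h grad_tangent chart_inv_at[OF c x]] by (simp add: chart_chart_inv[OF x])
  have "smooth_on (\<lambda>x. frechet_derivative (h \<circ> chart_inv c) (at x) (chart_grad c x)) (chart_range c)"
    by (rule smooth_on_apply[where D = "\<lambda>x. frechet_derivative (h \<circ> chart_inv c) (at x)",
          OF open_chart_range[OF c] smooth_on_frechet_derivative[OF Dh] smooth_on_chart_grad[OF c]
            has_derivative_linear[OF smooth_on_has_derivative[OF Dh]]])
  then show ?thesis
    using smooth_on_cong[OF open_chart_range[OF c], of "chart_norm2 c"] eq by simp
qed

lemma smooth_on_chart_unit:
  assumes c: "c \<in> A"
  shows "open {x \<in> chart_range c. chart_norm2 c x \<noteq> 0}"
    and "smooth_on (chart_unit c) {x \<in> chart_range c. chart_norm2 c x \<noteq> 0}"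
proof -
  let ?U = "{x \<in> chart_range c. chart_norm2 c x \<noteq> 0}"
  have "?U = chart_range c \<inter> chart_norm2 c -` (- {0})" by auto
  then show U: "open ?U"
    using continuous_open_preimage[OF smooth_on_imp_continuous_on[OF smooth_on_chart_norm2[OF c]]
        open_chart_range[OF c] open_Compl[OF closed_singleton]] by simp
  show "smooth_on (chart_unit c) ?U"
    unfolding chart_unit_def[abs_def]
    by (intro smooth_on_scaleR smooth_on_inverse U
        smooth_on_subset[OF smooth_on_chart_norm2[OF c]] smooth_on_subset[OF smooth_on_chart_grad[OF c]]) auto
qed

text \<open>The vector \<open>B\<close> below is the coordinate bracket of X with the gradient,
  obtained by differentiating \<open>z\<close> at 0. Invariance makes \<open>z t\<close> parallel to
  X along the trajectory \<open>a\<close>, so \<open>B\<close> is a multiple of X at time 0. Inner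
  products in the proof are those of the chart, not of \<open>g\<close>.\<close>

lemma bracket_parallel:
  assumes c: "c \<in> A" and x: "x \<in> chart_range c" and nz: "chart_field c x \<noteq> 0" "chart_norm2 c x \<noteq> 0"
  obtains \<mu> where "frechet_derivative (chart_unit c) (at x) (chart_field c x)
    = frechet_derivative (chart_field c) (at x) (chart_unit c x) + \<mu> *\<^sub>R chart_field c x"
proof -
  define m where "m = chart_inv c x"
  have cm: "c \<in> charts_at A m" unfolding m_def by (rule chart_inv_at[OF c x])
  have x_eq: "snd c m = x" unfolding m_def by (rule chart_chart_inv[OF x])
  obtain T r \<phi> M where T: "0 < T" and r: "0 < r" and ball: "ball x r \<subseteq> chart_range c"
    and \<phi>0: "\<And>y. y \<in> ball x r \<Longrightarrow> \<phi> 0 y = y"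
    and \<phi>_range: "\<And>y t. y \<in> ball x r \<Longrightarrow> t \<in> {-T<..<T} \<Longrightarrow> \<phi> t y \<in> chart_range c"
    and \<phi>: "\<And>y t. y \<in> ball x r \<Longrightarrow> t \<in> {-T<..<T} \<Longrightarrow>
      ((\<lambda>s. \<phi> s y) has_vector_derivative X (chart_inv c (\<phi> t y)) c) (at t)"
    and M: "\<And>t. t \<in> {-T<..<T} \<Longrightarrow> (\<phi> t has_derivative M t) (at x)"
    and M0: "\<And>w. M 0 w = w"
    and M': "\<And>w. ((\<lambda>t. M t w) has_vector_derivative
      frechet_derivative (\<lambda>x. X (chart_inv c x) c) (at x) w) (at 0)"
    and fl: "\<And>y t. y \<in> ball x r \<Longrightarrow> t \<in> {-T<..<T} \<Longrightarrow> flows_to A X t (chart_inv c y) (chart_inv c (\<phi> t y))"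
    by (rule flow_in_chart[OF X cm, unfolded x_eq]) blast
  define a where "a t = \<phi> t x" for t
  have x_ball: "x \<in> ball x r" using r by simp
  have a0: "a 0 = x" using \<phi>0[OF x_ball] by (simp add: a_def)
  have a_range: "a t \<in> chart_range c" if "t \<in> {-T<..<T}" for t
    unfolding a_def by (rule \<phi>_range[OF x_ball that])
  have a': "(a has_derivative (\<lambda>s. s *\<^sub>R chart_field c x)) (at 0)"
    using \<phi>[OF x_ball, of 0] T a0 unfolding has_vector_derivative_def
    by (simp add: a_def[symmetric] chart_field_def)
  define w where "w = chart_grad c x"
  have flow_facts: "chart_norm2 c (a t) = chart_norm2 c x"
    "\<xi> \<bullet> chart_field c (a t) = 0 \<Longrightarrow> \<xi> \<bullet> M t w = \<xi> \<bullet> chart_grad c (a t)"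
    if t: "t \<in> {-T<..<T}" for t \<xi>
  proof -
    have inv: "h (chart_inv c (\<phi> t y)) = h (chart_inv c y)" if y: "y \<in> ball x r" for y
      using first_integral_along_flow[OF c T \<phi>_range[OF y] \<phi>[OF y] t] \<phi>0[OF y] by simp
    note * = gradient_along_flow[OF cm open_ball, unfolded x_eq, OF x_ball ball fl[OF _ t]
        \<phi>_range[OF _ t] M[OF t] inv refl]
    show "chart_norm2 c (a t) = chart_norm2 c x"
      using *(1) by (simp add: chart_norm2_def a_def m_def)
    show "\<xi> \<bullet> chart_field c (a t) = 0 \<Longrightarrow> \<xi> \<bullet> M t w = \<xi> \<bullet> chart_grad c (a t)"
      using *(2)[of \<xi>] by (simp add: chart_field_def chart_grad_def a_def m_def w_def)
  qed
  let ?Y = "chart_field c x" and ?DY = "frechet_derivative (chart_field c) (at x)"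
  let ?DW = "frechet_derivative (chart_grad c) (at x)"
  define B where "B = ?DW ?Y - ?DY w"
  define z where "z t = chart_grad c (a t) - M t w" for t
  define u where "u t = chart_field c (a t)" for t
  have z0: "z 0 = 0" by (simp add: z_def a0 M0 w_def)
  have u0: "u 0 = ?Y" by (simp add: u_def a0)
  have along: "((\<lambda>t. f (a t)) has_derivative (\<lambda>s. s *\<^sub>R frechet_derivative f (at x) ?Y)) (at 0)"
    if f: "(f has_derivative frechet_derivative f (at x)) (at x)" for f :: "'e \<Rightarrow> 'e"
  proof -
    have "(f \<circ> a has_derivative frechet_derivative f (at x) \<circ> (\<lambda>s. s *\<^sub>R ?Y)) (at 0)"
      by (rule diff_chain_at[OF a']) (simp add: a0 f)
    then show ?thesis using linear_scale[OF has_derivative_linear[OF f]] by (simp add: o_def)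
  qed
  note DY = smooth_on_has_derivative[OF smooth_on_chart_field[OF c] x]
  note DW = smooth_on_has_derivative[OF smooth_on_chart_grad[OF c] x]
  have "((\<lambda>t. M t w) has_derivative (\<lambda>s. s *\<^sub>R ?DY w)) (at 0)"
    using M'[of w] by (simp add: has_vector_derivative_def chart_field_def[abs_def])
  from has_derivative_diff[OF along[OF DW] this]
  have z': "(z has_derivative (\<lambda>s. s *\<^sub>R B)) (at 0)"
    unfolding z_def[abs_def] B_def by (simp add: scaleR_diff_right)
  have u': "(u has_derivative (\<lambda>s. s *\<^sub>R ?DY ?Y)) (at 0)"
    unfolding u_def[abs_def] by (rule along[OF DY])
  \<comment> \<open>The component of \<open>z t\<close> orthogonal to \<open>u t\<close>, scaled by
    |u t|^2 to avoid a quotient. Because \<open>z 0\<close> is zero, only the derivative of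
    \<open>z\<close> survives in the derivative of \<open>k\<close> at 0.\<close>
  define k where "k t = (u t \<bullet> u t) *\<^sub>R z t - (z t \<bullet> u t) *\<^sub>R u t" for t
  have k': "(k has_derivative (\<lambda>s. s *\<^sub>R ((?Y \<bullet> ?Y) *\<^sub>R B - (B \<bullet> ?Y) *\<^sub>R ?Y))) (at 0)"
    unfolding k_def[abs_def]
    by (rule derivative_eq_intros z' u' refl)+ (simp add: z0 u0 fun_eq_iff algebra_simps)
  \<comment> \<open>The vector \<open>k t\<close> is itself orthogonal to X at \<open>a t\<close>,
    so it serves as the test vector and turns out to be orthogonal to itself.\<close>
  have k0: "k t = 0" if t: "t \<in> {-T<..<T}" for t
  proof -
    have ku: "k t \<bullet> u t = 0" by (simp add: k_def inner_diff_left)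
    then have "k t \<bullet> z t = 0"
      using flow_facts(2)[OF t, of "k t"] by (simp add: z_def u_def inner_diff_right)
    with ku have "k t \<bullet> k t = 0" by (subst (2) k_def) (simp add: inner_diff_right)
    then show ?thesis by simp
  qed
  have "(k has_derivative (\<lambda>s. 0)) (at 0)"
    by (rule has_derivative_transform_within_open[of "\<lambda>_. 0" _ _ UNIV "{-T<..<T}"]) (use T k0 in auto)
  from fun_cong[OF has_derivative_unique[OF k' this], of 1]
  have "(?Y \<bullet> ?Y) *\<^sub>R B = (B \<bullet> ?Y) *\<^sub>R ?Y" by simp
  then have "(1 / (?Y \<bullet> ?Y)) *\<^sub>R ((?Y \<bullet> ?Y) *\<^sub>R B) = (1 / (?Y \<bullet> ?Y)) *\<^sub>R ((B \<bullet> ?Y) *\<^sub>R ?Y)" by simp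
  then have B: "B = ((B \<bullet> ?Y) / (?Y \<bullet> ?Y)) *\<^sub>R ?Y" using nz(1) by simp
  define N where "N = chart_norm2 c x"
  have DV: "(chart_unit c has_derivative frechet_derivative (chart_unit c) (at x)) (at x)"
    using x nz by (intro smooth_on_has_derivative[OF smooth_on_chart_unit(2)[OF c]]) simp
  \<comment> \<open>As the squared norm of the gradient is constant along the trajectory,
    normalizing there is division by the fixed number \<open>N\<close>.\<close>
  have "((\<lambda>t. chart_grad c (a t) /\<^sub>R N) has_derivative (\<lambda>s. (s *\<^sub>R ?DW ?Y) /\<^sub>R N)) (at 0)"
    by (intro derivative_intros along DW)
  then have "((\<lambda>t. chart_unit c (a t)) has_derivative (\<lambda>s. (s *\<^sub>R ?DW ?Y) /\<^sub>R N)) (at 0)"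
  proof (rule has_derivative_transform_within_open)
    show "chart_grad c (a t) /\<^sub>R N = chart_unit c (a t)" if "t \<in> {-T<..<T}" for t
      using flow_facts(1)[OF that] by (simp add: chart_unit_def N_def)
  qed (use T in auto)
  from fun_cong[OF has_derivative_unique[OF along[OF DV] this], of 1]
  have "frechet_derivative (chart_unit c) (at x) ?Y = ?DW ?Y /\<^sub>R N" by simp
  moreover have "?DY (chart_unit c x) = ?DY w /\<^sub>R N"
    using linear_scale[OF has_derivative_linear[OF DY]] by (simp add: chart_unit_def w_def N_def)
  moreover have "?DW ?Y /\<^sub>R N = ?DY w /\<^sub>R N + B /\<^sub>R N" by (simp add: B_def scaleR_diff_right)
  ultimately have "frechet_derivative (chart_unit c) (at x) ?Y
      = ?DY (chart_unit c x) + (inverse N * ((B \<bullet> ?Y) / (?Y \<bullet> ?Y))) *\<^sub>R ?Y"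
    using B by (metis scaleR_scaleR)
  then show thesis by (rule that)
qed

section \<open>The bivector field: coefficients, Jacobi identity, smoothness, rank,
  Hamiltonian\<close>

definition "poisson_field p = (if p \<in> supp X then wedge (grad p /\<^sub>R gnorm2 p) (X p) else (\<lambda>\<alpha> \<beta>. 0))"

lemma X_eq_0_off_supp: "p \<notin> supp X \<Longrightarrow> X p = 0"
  using closure_subset[of "{p. X p \<noteq> 0}"] by (auto simp: supp_def)

text \<open>A wedge form at every point, with \<open>v\<close> zero off the support, so that
  \<open>sharp_wedge\<close> applies without case distinction.\<close>

lemma poisson_field_wedge:
  obtains v where "v \<in> tangent_space A p" "poisson_field p = wedge v (X p)"
    "p \<in> supp X \<Longrightarrow> v = grad p /\<^sub>R gnorm2 p"
proof (cases "p \<in> supp X")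
  case True
  then show ?thesis
    using that[OF subspace_scale[OF subspace_tangent grad_tangent, of "inverse (gnorm2 p)" p]]
    by (simp add: poisson_field_def)
next
  case False
  then have "poisson_field p = wedge 0 (X p)"
    by (simp add: poisson_field_def wedge_def X_eq_0_off_supp)
  then show ?thesis using that[OF subspace_0[OF subspace_tangent]] False by simp
qed

text \<open>Off the support both sides vanish along with X. Hence the formula holds on an open set
  that may cross the boundary of the support, and it can be differentiated there.\<close>

lemma bivec_coeff_poisson_field:
  assumes c: "c \<in> A" and x: "x \<in> chart_range c" and "chart_norm2 c x \<noteq> 0"
  shows "bivec_coeff A c poisson_field i j x
    = (chart_unit c x \<bullet> i) * (chart_field c x \<bullet> j) - (chart_field c x \<bullet> i) * (chart_unit c x \<bullet> j)"
proof (cases "chart_inv c x \<in> supp X")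
  case True
  have "grad (chart_inv c x) /\<^sub>R gnorm2 (chart_inv c x) \<in> tangent_space A (chart_inv c x)"
    by (rule subspace_scale[OF subspace_tangent grad_tangent])
  with True show ?thesis
    by (simp add: bivec_coeff_def poisson_field_def wedge_def coord_covec_apply X_tangent
        chart_unit_def chart_grad_def chart_norm2_def chart_field_def scaleR_fun_def)
next
  case False
  then show ?thesis
    using X_eq_0_off_supp[OF False] by (simp add: bivec_coeff_def poisson_field_def chart_field_def)
qed

lemma bivec_coeff_poisson_field_eq_0:
  assumes "X (chart_inv c x) = 0"
  shows "bivec_coeff A c poisson_field i j x = 0"
proof -
  have "coord_covec A c (chart_inv c x) k 0 = 0" for k
    by (simp add: coord_covec_def)
  then show ?thesis using assms by (simp add: bivec_coeff_def poisson_field_def wedge_def)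
qed

lemma schouten_poisson_field_eq_0:
  assumes c: "c \<in> A" and x: "x \<in> chart_range c" and N: "X (chart_inv c x) \<noteq> 0 \<Longrightarrow> chart_norm2 c x \<noteq> 0"
  shows "schouten_coeff A c poisson_field poisson_field i j k x = 0"
proof (cases "X (chart_inv c x) = 0")
  case True
  then show ?thesis by (simp add: schouten_coeff_def Let_def bivec_coeff_poisson_field_eq_0)
next
  case False
  let ?P = "bivec_coeff A c poisson_field"
  let ?V = "chart_unit c" and ?Y = "chart_field c"
  let ?DV = "frechet_derivative ?V (at x)" and ?DY = "frechet_derivative ?Y (at x)"
  have nz: "chart_norm2 c x \<noteq> 0" using N False by simp
  have cx: "c \<in> charts_at A (chart_inv c x)" by (rule chart_inv_at[OF c x])
  have Ynz: "?Y x \<noteq> 0"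
    using tangent_eqI[OF X_tangent subspace_0[OF subspace_tangent] cx] False by (auto simp: chart_field_def)
  obtain \<mu> where \<mu>: "?DV (?Y x) = ?DY (?V x) + \<mu> *\<^sub>R ?Y x"
    by (rule bracket_parallel[OF c x Ynz nz])
  have DV: "(?V has_derivative ?DV) (at x)"
    using x nz by (intro smooth_on_has_derivative[OF smooth_on_chart_unit(2)[OF c]]) simp
  have DY: "(?Y has_derivative ?DY) (at x)"
    by (rule smooth_on_has_derivative[OF smooth_on_chart_field[OF c] x])
  define DP where "DP j k w = ((?DV w \<bullet> j) * (?Y x \<bullet> k) + (?V x \<bullet> j) * (?DY w \<bullet> k))
      - ((?DY w \<bullet> j) * (?V x \<bullet> k) + (?Y x \<bullet> j) * (?DV w \<bullet> k))" for j k w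
  have "(?P j k has_derivative DP j k) (at x)" for j k
  proof -
    have "((\<lambda>y. (?V y \<bullet> j) * (?Y y \<bullet> k) - (?Y y \<bullet> j) * (?V y \<bullet> k)) has_derivative DP j k) (at x)"
      unfolding DP_def[abs_def]
      by (rule derivative_eq_intros DV DY refl)+ (simp add: fun_eq_iff algebra_simps)
    then show ?thesis
      by (rule has_derivative_transform_within_open[OF _ smooth_on_chart_unit(1)[OF c]])
        (use x nz bivec_coeff_poisson_field[OF c] in auto)
  qed
  note DP = this
  have "(\<Sum>l\<in>Basis. ?P i l x * frechet_derivative (?P j k) (at x) l)
      = (?V x \<bullet> i) * DP j k (?Y x) - (?Y x \<bullet> i) * DP j k (?V x)" for i j k
  proof -
    have "frechet_derivative (?P j k) (at x) = DP j k" using frechet_derivative_at[OF DP] by simp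
    then show ?thesis
      using sum_Basis_linear[OF has_derivative_linear[OF DP]] by (simp add: bivec_coeff_poisson_field[OF c x nz])
  qed
  then show ?thesis
    using schouten_polynomial[where v = "\<lambda>i. ?V x \<bullet> i" and y = "\<lambda>i. ?Y x \<bullet> i" and \<mu> = \<mu>
        and b = "\<lambda>i. ?DY (?V x) \<bullet> i" and p = "\<lambda>i. ?DY (?Y x) \<bullet> i" and q = "\<lambda>i. ?DV (?V x) \<bullet> i"
        and i = i and j = j and k = k]
    by (simp add: schouten_coeff_def Let_def DP_def \<mu> inner_add_left)
qed

text \<open>The set \<open>?U\<close> contains all chart points of the support and carries the
  explicit formula; \<open>?U'\<close> is the open complement of the support, where the coefficients
  are 0. Together they cover the chart.\<close>

lemma smooth_on_bivec_coeff_poisson_field: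
  assumes c: "c \<in> A" and N: "\<And>p. p \<in> supp X \<Longrightarrow> gnorm2 p \<noteq> 0"
  shows "smooth_on (bivec_coeff A c poisson_field i j) (chart_range c)"
proof -
  let ?U = "{x \<in> chart_range c. chart_norm2 c x \<noteq> 0}"
  let ?U' = "chart_range c \<inter> chart_inv c -` (- supp X)"
  have U: "open ?U" and U': "open ?U'"
    using smooth_on_chart_unit(1)[OF c]
      continuous_open_preimage[OF homeomorphism_cont2[OF homeomorphism_chart[OF c]] open_chart_range[OF c]]
    by (simp_all add: supp_def open_Compl)
  have "smooth_on (\<lambda>x. (chart_unit c x \<bullet> i) * (chart_field c x \<bullet> j)
      - (chart_field c x \<bullet> i) * (chart_unit c x \<bullet> j)) ?U"
    using smooth_on_subset[OF smooth_on_chart_field[OF c], of ?U]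
    by (intro smooth_on_diff smooth_on_mult smooth_on_inner smooth_on_const U
        smooth_on_chart_unit(2)[OF c]) auto
  then have "smooth_on (bivec_coeff A c poisson_field i j) ?U"
    by (subst smooth_on_cong[OF U]) (use bivec_coeff_poisson_field[OF c] in auto)
  moreover have "smooth_on (bivec_coeff A c poisson_field i j) ?U'"
    using smooth_on_const[OF U', of 0]
    by (subst smooth_on_cong[OF U', where g = "\<lambda>_. 0"]) (auto simp: bivec_coeff_def poisson_field_def)
  moreover have "chart_range c = ?U \<union> ?U'" using N by (auto simp: chart_norm2_def)
  ultimately show ?thesis using smooth_on_Un[OF U U'] by simp
qed

lemma gnorm2_nonzero:
  assumes "diff_fun A h p \<noteq> 0"
  shows "gnorm2 p \<noteq> 0"
proof
  assume "gnorm2 p = 0"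
  then have g0: "grad p = 0" using metric_pos[OF grad_tangent, of p] by (auto simp: gnorm2_def)
  have "diff_fun A h p v = 0" for v
  proof (cases "v \<in> tangent_space A p")
    case v: True
    have "g p v (0 *\<^sub>R v) = 0 * g p v v"
      using metric_linear[OF v] v unfolding linear_functional_on_def by blast
    moreover have "diff_fun A h p v = g p v (grad p)"
      using metric_gradient[OF h v] metric_sym[OF v grad_tangent] by simp
    ultimately show ?thesis by (simp add: g0)
  qed (simp add: diff_fun_def)
  then show False using assms by (auto simp: fun_eq_iff)
qed

lemma poisson_structure_poisson_field:
  assumes "regular_on A h (supp X)"
  shows "poisson_structure A poisson_field"
proof -
  have N: "gnorm2 p \<noteq> 0" if "p \<in> supp X" for p
    using assms that gnorm2_nonzero by (simp add: regular_on_def)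
  have N': "chart_norm2 c x \<noteq> 0" if "X (chart_inv c x) \<noteq> 0" for c x
    using N X_eq_0_off_supp that unfolding chart_norm2_def by blast
  have "linear_functional_on (cotangent_space A p) (poisson_field p \<alpha>)
      \<and> (\<forall>\<beta>\<in>cotangent_space A p. poisson_field p \<alpha> \<beta> = - poisson_field p \<beta> \<alpha>)" for p \<alpha>
    by (auto simp: poisson_field_def wedge_def linear_functional_on_def scaleR_fun_def algebra_simps)
  moreover have "smooth_on (bivec_coeff A c poisson_field i j) (chart_range c)" if "c \<in> A" for c i j
    by (rule smooth_on_bivec_coeff_poisson_field[OF that N])
  moreover have "schouten_coeff A c poisson_field poisson_field i j k x = 0"
    if "c \<in> A" "x \<in> chart_range c" for c x i j k
    by (rule schouten_poisson_field_eq_0[OF that N'])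
  ultimately show ?thesis unfolding poisson_structure_def bivector_field_def by blast
qed

lemma bivec_rank_poisson_field: "bivec_rank A poisson_field p \<le> 2"
proof -
  obtain v where v: "v \<in> tangent_space A p" "poisson_field p = wedge v (X p)"
    by (rule poisson_field_wedge[of p]) blast
  have "sharp A p (poisson_field p) \<alpha> \<in> span {v, X p}" if "\<alpha> \<in> cotangent_space A p" for \<alpha>
    unfolding v(2) sharp_wedge[OF v(1) X_tangent that]
    by (intro span_diff span_scale span_base) auto
  then have "dim (sharp A p (poisson_field p) ` cotangent_space A p) \<le> card {v, X p}"
    by (intro dim_le_card) auto
  also have "\<dots> \<le> 2" by (simp add: card_insert_if)
  finally show ?thesis by (simp add: bivec_rank_def)
qed

lemma hamiltonian_poisson_field:
  assumes "regular_on A h (supp X)"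
  shows "hamiltonian A poisson_field X"
  unfolding hamiltonian_def
proof (rule exI[of _ h], intro conjI allI)
  show "smooth_fun A h" by (rule h)
  fix p
  note dh = diff_fun_cotangent[OF h, of p]
  obtain v where v: "v \<in> tangent_space A p" "poisson_field p = wedge v (X p)"
    "p \<in> supp X \<Longrightarrow> v = grad p /\<^sub>R gnorm2 p"
    by (rule poisson_field_wedge[of p]) blast
  have "diff_fun A h p v *\<^sub>R X p = X p"
  proof (cases "p \<in> supp X")
    case True
    then have "gnorm2 p \<noteq> 0" using assms gnorm2_nonzero by (simp add: regular_on_def)
    then show ?thesis
      using v(3)[OF True] cotangent_scaleR[OF dh grad_tangent] by (simp add: diff_fun_grad)
  qed (simp add: X_eq_0_off_supp)
  then show "X p = sharp A p (poisson_field p) (diff_fun A h p)"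
    unfolding v(2) sharp_wedge[OF v(1) X_tangent dh] by (simp add: diff_fun_X)
qed

end

theorem theorem4p13:
  fixes A :: "('a::{t2_space, second_countable_topology}, 'e::euclidean_space) chart set"
    and X :: "'a \<Rightarrow> ('a, 'e) tvec"
    and h :: "'a \<Rightarrow> real"
    and g :: "('a, 'e) metric_field"
    and \<pi> :: "'a \<Rightarrow> ('a, 'e) bivec"
  assumes "smooth_atlas A"
    and "vector_field A X"
    and "first_integral A X h"
    and "regular_on A h (supp X)"
    and "riemannian_metric A g"
    and "transversally_invariant A X g"
    and "\<pi> = (\<lambda>p. if p \<in> supp X
      then wedge (gradient A g h p /\<^sub>R g p (gradient A g h p) (gradient A g h p)) (X p)
      else (\<lambda>\<alpha> \<beta>. 0))"
  shows "poisson_structure A \<pi> \<and> (\<forall>p. bivec_rank A \<pi> p \<le> 2) \<and> hamiltonian A \<pi> X"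
proof -
  interpret transversally_invariant_field A g X h
    using assms by unfold_locales
  have "\<pi> = poisson_field"
    by (rule ext) (simp add: assms(7) poisson_field_def gnorm2_def)
  then show ?thesis
    using poisson_structure_poisson_field bivec_rank_poisson_field hamiltonian_poisson_field assms(4) by simp
qed

end
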